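(* (a) If $f\in C^3[0,1]$ and $f'''\geq 0$ in $[0,1]$, then for all integers $n\geq 4$, $$0\leq R\big[Q_{n+1}^{R,l};f\big]\leq \Big(\frac{\sqrt{3}}{216n^3}-\frac{1}{269.14\,n^4}\Big)\|f'''\|,$$ $$0\geq R\big[Q_{n+1}^{R,r};f\big]\geq -\Big(\frac{\sqrt{3}}{216n^3}-\frac{1}{269.14\,n^4}\Big)\|f'''\|,$$ where $Q_{n+1}^{R,l}$ and $Q_{n+1}^{R,r}$ are the $(n+1)$-point left and right Radau quadrature formulae associated with the spline space $S_{n,3}$. (b) If $f\in C^4[0,1]$ and $f^{(4)}\geq 0$ in $[0,1]$, then for all integers $n\geq 4$, $$0\leq R\big[Q_{n+1}^{G};f\big]\leq \Big(\frac{1}{720n^4}-\frac{1}{552n^5}\Big)\|f^{(4)}\|,$$ where $Q_{n+1}^{G}$ is the $(n+1)$-point Gauss quadrature formula associated with the spline space $S_{n,4}$.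
   Context: Notation. $\|\cdot\|$ is the supremum norm on $[0,1]$ and $I[f]=\int_0^1 f(x)\,dx$. A quadrature formula is a linear functional $Q[f]=\sum_{i=1}^{m}a_i f(\tau_i)$ with real weights $a_i$ and nodes $0\le\tau_1<\dots<\tau_m\le 1$ (an $m$-point formula); its remainder is $R[Q;f]=I[f]-Q[f]$. Spline spaces. For $n\ge 2$, $r\in\{3,4\}$ and $x_k=k/n$, $k=0,\dots,n$, $S_{n,r}$ is the linear space of all $f\in C^{r-3}[0,1]$ whose restriction to each $(x_k,x_{k+1})$, $k=0,\dots,n-1$, is a polynomial of degree at most $r-1$. Radau formulae. The right Radau formula $Q_{n+1}^{R,r}$ associated with $S_{n,3}$ is the unique $(n+1)$-point quadrature formula of the form $\sum_{k=0}^{n-1}a_{k,n}f(\tau_{k,n})+a_{n,n}f(1)$ with $0<\tau_{0,n}<\dots<\tau_{n-1,n}<1$ and $R[Q_{n+1}^{R,r};f]=0$ for all $f\in S_{n,3}$. It is known explicitly: $\tau_{k,n}=(k+\theta_k)/n$ and $a_{k,n}=\frac{1}{6n\theta_k(1-\theta_k)}$ for $k=0,\dots,n-1$, and $a_{n,n}=\frac{2-3\theta_{n-1}}{6n(1-\theta_{n-1})}$, where $\theta_0=1/3$ and $\theta_k=\frac{1-\theta_{k-1}}{5-6\theta_{k-1}}$ for $k\ge1$. The left Radau formula $Q_{n+1}^{R,l}$ is its reflection, $Q_{n+1}^{R,l}[f]=Q_{n+1}^{R,r}[f(1-\cdot)]$. Gauss formula. $Q_{n+1}^{G}$ is the quadrature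 formula $\sum_{i=1}^{n+1}a_{i}f(\tau_{i})$ with $0<\tau_1<\dots<\tau_{n+1}<1$ determined uniquely by the property $Q_{n+1}^G[f]=I[f]$ for every $f\in S_{n,4}$ (it is known to exist, to be unique, and to have positive weights). *)

theory Defs
  imports "HOL-Analysis.Analysis" "HOL-Computational_Algebra.Polynomial"
begin

(* Derivatives are taken relative to [0,1], hence one-sided at 0 and 1, so that nothing depends
   on the values of f outside [0,1]. *)

definition deriv01 :: "(real \<Rightarrow> real) \<Rightarrow> real \<Rightarrow> real" where
  "deriv01 f x = vector_derivative f (at x within {0..1})"

definition higher_deriv01 :: "nat \<Rightarrow> (real \<Rightarrow> real) \<Rightarrow> real \<Rightarrow> real" where
  "higher_deriv01 k f = (deriv01 ^^ k) f"

definition C01 :: "nat \<Rightarrow> (real \<Rightarrow> real) set" where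
  "C01 k = {f. (\<forall>j<k. higher_deriv01 j f differentiable_on {0..1}) \<and>
               continuous_on {0..1} (higher_deriv01 k f)}"

definition supnorm01 :: "(real \<Rightarrow> real) \<Rightarrow> real" where
  "supnorm01 f = (SUP x\<in>{0..1}. \<bar>f x\<bar>)"

(* The subtraction r - 3 is on nat: the definition is meant for r = 3 and r = 4. *)
definition spline_space :: "nat \<Rightarrow> nat \<Rightarrow> (real \<Rightarrow> real) set" where
  "spline_space n r = {f. f \<in> C01 (r - 3) \<and>
     (\<forall>k<n. \<exists>p :: real poly. degree p \<le> r - 1 \<and>
        (\<forall>x\<in>{real k / real n <..< real (k + 1) / real n}. f x = poly p x))}"

definition quad :: "nat \<Rightarrow> (nat \<Rightarrow> real) \<Rightarrow> (nat \<Rightarrow> real) \<Rightarrow> (real \<Rightarrow> real) \<Rightarrow> real" where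
  "quad m a \<tau> f = (\<Sum>i<m. a i * f (\<tau> i))"

definition remainder :: "((real \<Rightarrow> real) \<Rightarrow> real) \<Rightarrow> (real \<Rightarrow> real) \<Rightarrow> real" where
  "remainder Q f = integral {0..1} f - Q f"

(* The three formulae below are specified by the properties that determine them uniquely.
   Indices run over 0..n, i.e. there are n + 1 nodes. *)

definition is_right_radau :: "nat \<Rightarrow> ((real \<Rightarrow> real) \<Rightarrow> real) \<Rightarrow> bool" where
  "is_right_radau n Q \<longleftrightarrow>
     (\<exists>a \<tau>. Q = quad (n + 1) a \<tau> \<and> 0 < \<tau> 0 \<and> strict_mono_on {..n} \<tau> \<and> \<tau> n = 1) \<and>
     (\<forall>f\<in>spline_space n 3. remainder Q f = 0)"

definition is_left_radau :: "nat \<Rightarrow> ((real \<Rightarrow> real) \<Rightarrow> real) \<Rightarrow> bool" where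
  "is_left_radau n Q \<longleftrightarrow> (\<exists>Q'. is_right_radau n Q' \<and> Q = (\<lambda>f. Q' (\<lambda>x. f (1 - x))))"

definition is_gauss :: "nat \<Rightarrow> ((real \<Rightarrow> real) \<Rightarrow> real) \<Rightarrow> bool" where
  "is_gauss n Q \<longleftrightarrow>
     (\<exists>a \<tau>. Q = quad (n + 1) a \<tau> \<and> 0 < \<tau> 0 \<and> strict_mono_on {..n} \<tau> \<and> \<tau> n < 1) \<and>
     (\<forall>f\<in>spline_space n 4. remainder Q f = 0)"

end

(* By Peano's theorem the remainder is the integral of K * f^(r), where K is a monospline that
   vanishes together with its derivative at all knots. After scaling the knots to 0, ..., n, two
   things remain: the sign of K, and the value of the remainder on x^r.

   Radau (r = 3). The bubbles supported on a single cell force exactly one node k + theta_k into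
   each cell, with weight 1 / (6 theta_k (1 - theta_k)), and the hat functions yield the recursion
   for theta_k. Then K is explicit and nonpositive on each cell, and subtracting a Bernoulli spline
   from x^3 gives its remainder as a sum of (theta_k - 1/2) / 6. As theta_k decreases to the fixed
   point (3 - sqrt 3) / 6 of the recursion, the first four terms give the correction term.

   Gauss (r = 4). The location of the nodes is not needed. On every cell Rolle's theorem provides
   two zeros of K'', which is quadratic between consecutive nodes; counting zeros shows that they
   interlace with the nodes in pairs. This gives positive weights and K >= 0. Subtracting a
   Bernoulli spline turns x^4 into the bubble u^2 (1 - u)^2 on each cell, and by positivity of the
   weights any spline below the bubble bounds the quadrature sum of the bubble from below; one such
   spline, supported on the two outermost cells at either end, yields exactly 1 / 552. *)

theory Submission
  imports Defs
begin

section \<open>Truncated powers as splines\<close>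

definition pos :: "real \<Rightarrow> real" where
  "pos x = max 0 x"

lemma pos_of_nonneg [simp]: "0 \<le> x \<Longrightarrow> pos x = x"
  and pos_of_nonpos [simp]: "x \<le> 0 \<Longrightarrow> pos x = 0"
  and pos_nonneg [simp]: "0 \<le> pos x"
  by (auto simp: pos_def)

lemma continuous_on_pos [continuous_intros]:
  "continuous_on S f \<Longrightarrow> continuous_on S (\<lambda>x. pos (f x))"
  unfolding pos_def by (intro continuous_intros)

lemma pos_mult: "0 \<le> c \<Longrightarrow> pos (c * x) = c * pos x"
  by (auto simp: pos_def max_def zero_le_mult_iff mult_le_0_iff)

text \<open>The exponent is at least 2, which makes the two one-sided derivatives at 0 agree; the
  first power has a corner there.\<close>

lemma DERIV_pos_power:
  "((\<lambda>x. pos x ^ Suc (Suc m)) has_real_derivative real (m + 2) * pos x ^ Suc m) (at x)"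
proof -
  consider "x < 0" | "x = 0" | "0 < x" by linarith
  then show ?thesis
  proof cases
    case 1
    have "((\<lambda>_. 0) has_real_derivative real (m + 2) * pos x ^ Suc m) (at x)"
      using 1 by simp
    then show ?thesis
      by (rule has_field_derivative_transform_within_open[where S = "{..<0}"]) (use 1 in auto)
  next
    case 2
    have "((\<lambda>h. pos h ^ Suc (Suc m) / h) \<longlongrightarrow> 0) (at 0)"
    proof (rule Lim_null_comparison)
      have "((\<lambda>h::real. \<bar>h\<bar> ^ Suc m) \<longlongrightarrow> \<bar>0\<bar> ^ Suc m) (at 0)"
        by (intro tendsto_intros)
      then show "((\<lambda>h::real. \<bar>h\<bar> ^ Suc m) \<longlongrightarrow> 0) (at 0)" by simp
      have "norm (pos h ^ Suc (Suc m) / h) \<le> \<bar>h\<bar> ^ Suc m" if "h \<noteq> 0" for h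
        using that by (cases "0 < h") (auto intro: mult_nonpos_nonneg)
      then show "\<forall>\<^sub>F h in at 0. norm (pos h ^ Suc (Suc m) / h) \<le> \<bar>h\<bar> ^ Suc m"
        by (simp add: eventually_at_filter)
    qed
    then show ?thesis
      using 2 by (simp add: DERIV_def)
  next
    case 3
    have "((\<lambda>x. x ^ Suc (Suc m)) has_real_derivative real (m + 2) * pos x ^ Suc m) (at x)"
      using DERIV_pow[of "Suc (Suc m)" x UNIV] 3 by simp
    then show ?thesis
      by (rule has_field_derivative_transform_within_open[where S = "{0<..}"]) (use 3 in auto)
  qed
qed

lemma DERIV_pos_diff_power:
  "((\<lambda>x. pos (x - c) ^ Suc (Suc m)) has_real_derivative real (m + 2) * pos (x - c) ^ Suc m) (at x)"
proof -
  have "((\<lambda>x. x - c) has_real_derivative 1) (at x)"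
    by (auto intro!: derivative_eq_intros)
  from DERIV_chain2[where g = "\<lambda>x. x - c", OF DERIV_pos_power this] show ?thesis by simp
qed

lemma DERIV_pos_diff_power':
  "((\<lambda>x. pos (c - x) ^ Suc (Suc m)) has_real_derivative - (real (m + 2) * pos (c - x) ^ Suc m)) (at x)"
proof -
  have "((\<lambda>x. c - x) has_real_derivative - 1) (at x)"
    by (auto intro!: derivative_eq_intros)
  from DERIV_chain2[where g = "\<lambda>x. c - x", OF DERIV_pos_power this] show ?thesis by simp
qed

lemma has_integral_pos_diff_power:
  assumes "0 \<le> c" "c \<le> 1"
  shows "((\<lambda>x. pos (x - c) ^ Suc p) has_integral (1 - c) ^ (p + 2) / real (p + 2)) {0..1}"
proof -
  have "((\<lambda>x. pos (x - c) ^ Suc p) has_integral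
      pos (1 - c) ^ Suc (Suc p) / real (p + 2) - pos (0 - c) ^ Suc (Suc p) / real (p + 2)) {0..1}"
  proof (rule fundamental_theorem_of_calculus, simp)
    fix x
    have "((\<lambda>x. pos (x - c) ^ Suc (Suc p) / real (p + 2)) has_real_derivative pos (x - c) ^ Suc p) (at x)"
      using DERIV_cdivide[OF DERIV_pos_diff_power[of c p x], of "real (p + 2)"] by simp
    then show "((\<lambda>x. pos (x - c) ^ Suc (Suc p) / real (p + 2)) has_vector_derivative pos (x - c) ^ Suc p)
        (at x within {0..1})"
      by (simp add: has_field_derivative_at_within has_real_derivative_iff_has_vector_derivative[symmetric])
  qed
  then show ?thesis
    using assms by simp
qed

lemma has_integral_pos_diff_power':
  assumes "0 \<le> c" "c \<le> 1"
  shows "((\<lambda>x. pos (c - x) ^ Suc p) has_integral c ^ (p + 2) / real (p + 2)) {0..1}"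
proof -
  have "((\<lambda>x. pos (c - x) ^ Suc p) has_integral
      - (pos (c - 1) ^ Suc (Suc p) / real (p + 2)) - (- (pos (c - 0) ^ Suc (Suc p) / real (p + 2)))) {0..1}"
  proof (rule fundamental_theorem_of_calculus, simp)
    fix x
    have "((\<lambda>x. - (pos (c - x) ^ Suc (Suc p) / real (p + 2))) has_real_derivative pos (c - x) ^ Suc p) (at x)"
      using DERIV_minus[OF DERIV_cdivide[OF DERIV_pos_diff_power'[of c p x], of "real (p + 2)"]] by simp
    then show "((\<lambda>x. - (pos (c - x) ^ Suc (Suc p) / real (p + 2))) has_vector_derivative pos (c - x) ^ Suc p)
        (at x within {0..1})"
      by (simp add: has_field_derivative_at_within has_real_derivative_iff_has_vector_derivative[symmetric])
  qed
  then show ?thesis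
    using assms by simp
qed

lemma has_integral_power_01: "((\<lambda>x::real. x ^ p) has_integral 1 / real (Suc p)) {0..1}"
proof -
  have "((\<lambda>x::real. x ^ p) has_integral 1 ^ Suc p / real (Suc p) - 0 ^ Suc p / real (Suc p)) {0..1}"
  proof (rule fundamental_theorem_of_calculus, simp)
    fix x :: real
    have "((\<lambda>x. x ^ Suc p / real (Suc p)) has_real_derivative x ^ p) (at x within {0..1})"
      using DERIV_cdivide[OF DERIV_pow[of "Suc p" x "{0..1}"], of "real (Suc p)"] by simp
    then show "((\<lambda>x. x ^ Suc p / real (Suc p)) has_vector_derivative x ^ p) (at x within {0..1})"
      by (simp add: has_real_derivative_iff_has_vector_derivative)
  qed
  then show ?thesis by simp
qed

section \<open>Membership in the spline spaces\<close>

lemma spline_space_3I: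
  assumes "continuous_on {0..1} f"
    and "\<And>j. j < n \<Longrightarrow> \<exists>p :: real poly. degree p \<le> 3 - 1 \<and>
        (\<forall>x\<in>{real j / real n <..< real (j + 1) / real n}. f x = poly p x)"
  shows "f \<in> spline_space n 3"
proof -
  have "f \<in> C01 (3 - 3)"
    using assms(1) by (simp add: C01_def higher_deriv01_def)
  then show ?thesis
    unfolding spline_space_def using assms(2) by blast
qed

lemma deriv01_eq:
  assumes "(f has_real_derivative d) (at x within {0..1})" "x \<in> {0..1}"
  shows "deriv01 f x = d"
  unfolding deriv01_def
  by (rule vector_derivative_within_closed_interval)
    (use assms in \<open>simp_all add: has_real_derivative_iff_has_vector_derivative\<close>)

lemma spline_space_4I:
  assumes f: "\<And>x. (f has_real_derivative f' x) (at x)" and f': "continuous_on {0..1} f'"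
    and "\<And>j. j < n \<Longrightarrow> \<exists>p :: real poly. degree p \<le> 4 - 1 \<and>
        (\<forall>x\<in>{real j / real n <..< real (j + 1) / real n}. f x = poly p x)"
  shows "f \<in> spline_space n 4"
proof -
  have "f differentiable_on {0..1}"
    unfolding differentiable_on_def
    using has_field_derivative_at_within[OF f]
    by (blast intro: differentiableI has_field_derivative_imp_has_derivative)
  moreover have "continuous_on {0..1} (deriv01 f)"
    using f' deriv01_eq[OF has_field_derivative_at_within[OF f]]
    by (subst continuous_on_cong[OF refl]) auto
  ultimately have "f \<in> C01 (4 - 3)"
    by (simp add: C01_def higher_deriv01_def)
  then show ?thesis
    unfolding spline_space_def using assms(3) by blast
qed

text \<open>Every cell lies entirely on one side of the knot, so the truncated power is there either
  the full power or zero.\<close>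

lemma pos_power_piecewise_poly:
  assumes "0 < p"
  shows "\<exists>q :: real poly. degree q \<le> p \<and>
      (\<forall>x\<in>{real j / real n <..< real (j + 1) / real n}. pos (x - real k / real n) ^ p = poly q x)"
proof (cases "k \<le> j")
  case True
  then have k: "real k / real n \<le> real j / real n" by (simp add: divide_right_mono)
  have "pos (x - real k / real n) ^ p = poly ([:- (real k / real n), 1:] ^ p) x"
    if "real j / real n < x" for x
  proof -
    have "0 \<le> x - real k / real n" using that k by linarith
    then show ?thesis by (simp only: pos_of_nonneg) (simp add: algebra_simps)
  qed
  then show ?thesis
    by (intro exI[of _ "[:- (real k / real n), 1:] ^ p"]) (simp add: degree_power_eq)
next
  case False
  then have k: "real (j + 1) / real n \<le> real k / real n" by (intro divide_right_mono) auto
  have "pos (x - real k / real n) ^ p = poly 0 x" if "x < real (j + 1) / real n" for x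
  proof -
    have "x - real k / real n \<le> 0" using that k by linarith
    then show ?thesis using assms by (simp only: pos_of_nonpos) simp
  qed
  then show ?thesis
    using assms by (intro exI[of _ 0]) simp
qed

lemma pos_power_piecewise_poly':
  assumes "0 < p"
  shows "\<exists>q :: real poly. degree q \<le> p \<and>
      (\<forall>x\<in>{real j / real n <..< real (j + 1) / real n}. pos (real k / real n - x) ^ p = poly q x)"
proof (cases "k \<le> j")
  case True
  then have k: "real k / real n \<le> real j / real n" by (simp add: divide_right_mono)
  have "pos (real k / real n - x) ^ p = poly 0 x" if "real j / real n < x" for x
  proof -
    have "real k / real n - x \<le> 0" using that k by linarith
    then show ?thesis using assms by (simp only: pos_of_nonpos) simp
  qed
  then show ?thesis
    using assms by (intro exI[of _ 0]) simp
next
  case False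
  then have k: "real (j + 1) / real n \<le> real k / real n" by (intro divide_right_mono) auto
  have "pos (real k / real n - x) ^ p = poly ([:real k / real n, - 1:] ^ p) x"
    if "x < real (j + 1) / real n" for x
  proof -
    have "0 \<le> real k / real n - x" using that k by linarith
    then show ?thesis by (simp only: pos_of_nonneg) (simp add: algebra_simps)
  qed
  then show ?thesis
    by (intro exI[of _ "[:real k / real n, - 1:] ^ p"]) (simp add: degree_power_eq)
qed

text \<open>In degrees r - 2 and r - 1 a truncated power is smooth enough across its knot and still
  of low enough degree. Together with the monomials these are the only splines to which exactness is
  ever applied.\<close>

lemma pos_power_in_spline_space:
  assumes "r \<in> {3, 4}" "r - 2 \<le> p" "p < r"
  shows "(\<lambda>x. pos (x - real k / real n) ^ p) \<in> spline_space n r" (is "?f \<in> _")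
    and "(\<lambda>x. pos (real k / real n - x) ^ p) \<in> spline_space n r" (is "?g \<in> _")
proof -
  have p: "0 < p" "p \<le> r - 1" using assms by auto
  have f: "\<exists>q :: real poly. degree q \<le> r - 1 \<and>
      (\<forall>x\<in>{real j / real n <..< real (j + 1) / real n}. ?f x = poly q x)" for j
    using pos_power_piecewise_poly[OF p(1), of j n k] order_trans[OF _ p(2)] by fast
  have g: "\<exists>q :: real poly. degree q \<le> r - 1 \<and>
      (\<forall>x\<in>{real j / real n <..< real (j + 1) / real n}. ?g x = poly q x)" for j
    using pos_power_piecewise_poly'[OF p(1), of j n k] order_trans[OF _ p(2)] by fast
  have "?f \<in> spline_space n r \<and> ?g \<in> spline_space n r"
  proof (cases "r = 3")
    case True
    then show ?thesis
      using f g by (auto intro!: spline_space_3I continuous_intros)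
  next
    case False
    define m where "m = p - 2"
    have m: "p = Suc (Suc m)" and r: "r = 4" "r - 1 = 3"
      using assms False by (auto simp: m_def)
    have "?f \<in> spline_space n 4"
    proof (rule spline_space_4I)
      show "(?f has_real_derivative real (m + 2) * pos (x - real k / real n) ^ Suc m) (at x)" for x
        unfolding m by (rule DERIV_pos_diff_power)
    qed (use f r in \<open>auto intro!: continuous_intros\<close>)
    moreover have "?g \<in> spline_space n 4"
    proof (rule spline_space_4I)
      show "(?g has_real_derivative - (real (m + 2) * pos (real k / real n - x) ^ Suc m)) (at x)" for x
        unfolding m by (rule DERIV_pos_diff_power')
    qed (use g r in \<open>auto intro!: continuous_intros\<close>)
    ultimately show ?thesis using r by simp
  qed
  then show "?f \<in> spline_space n r" "?g \<in> spline_space n r" by auto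
qed

lemma power_in_spline_space:
  assumes "r \<in> {3, 4}" "p < r"
  shows "(\<lambda>x. x ^ p) \<in> spline_space n r"
proof -
  have poly: "\<exists>q :: real poly. degree q \<le> r - 1 \<and>
      (\<forall>x\<in>{real j / real n <..< real (j + 1) / real n}. x ^ p = poly q x)" for j
    using assms by (intro exI[of _ "monom 1 p"]) (auto simp: poly_monom degree_monom_eq)
  show ?thesis
  proof (cases "r = 3")
    case True
    then show ?thesis
      using poly by (auto intro!: spline_space_3I continuous_intros)
  next
    case False
    have "(\<lambda>x. x ^ p) \<in> spline_space n 4"
      by (rule spline_space_4I[where f' = "\<lambda>x. real p * x ^ (p - 1)"])
        (use poly False assms in \<open>auto intro!: derivative_eq_intros continuous_intros\<close>)
    then show ?thesis using False assms by auto
  qed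
qed

section \<open>The Peano kernel and the scaled quadrature formula\<close>

text \<open>The truncated power extends the integration from [0, x] to the fixed interval [0, 1], so
  that the formulas for several nodes can be added under one integral. It vanishes beyond x because
  \<open>p - 1\<close> is positive.\<close>

lemma has_integral_Taylor_remainder_01:
  fixes Df :: "nat \<Rightarrow> real \<Rightarrow> real"
  assumes D: "\<And>m s. m < p \<Longrightarrow> s \<in> {0..1} \<Longrightarrow>
      (Df m has_real_derivative Df (Suc m) s) (at s within {0..1})"
    and p: "2 \<le> p" and x: "x \<in> {0..1}"
  shows "((\<lambda>s. pos (x - s) ^ (p - 1) / fact (p - 1) * Df p s) has_integral
      (Df 0 x - (\<Sum>j<p. x ^ j / fact j * Df j 0))) {0..1}"
proof -
  have "((\<lambda>s. ((x - s) ^ (p - 1) / fact (p - 1)) *\<^sub>R Df p s) has_integral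
      Df 0 x - (\<Sum>j<p. ((x - 0) ^ j / fact j) *\<^sub>R Df j 0)) {0..x}"
  proof (rule Taylor_has_integral)
    show "(Df m has_vector_derivative Df (Suc m) s) (at s within {0..x})"
      if "m < p" "0 \<le> s" "s \<le> x" for m s
    proof -
      have "(Df m has_real_derivative Df (Suc m) s) (at s within {0..x})"
        by (rule DERIV_subset[OF D[OF that(1)]]) (use that x in auto)
      then show ?thesis
        by (simp add: has_real_derivative_iff_has_vector_derivative)
    qed
  qed (use p x in auto)
  then have "((\<lambda>s. pos (x - s) ^ (p - 1) / fact (p - 1) * Df p s) has_integral
      Df 0 x - (\<Sum>j<p. x ^ j / fact j * Df j 0)) {0..x}"
    by (subst has_integral_cong[where g = "\<lambda>s. ((x - s) ^ (p - 1) / fact (p - 1)) *\<^sub>R Df p s"]) auto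
  then have "((\<lambda>s. if s \<in> {0..x} then pos (x - s) ^ (p - 1) / fact (p - 1) * Df p s else 0)
      has_integral Df 0 x - (\<Sum>j<p. x ^ j / fact j * Df j 0)) {0..1}"
    by (subst has_integral_restrict) (use x in auto)
  then show ?thesis
    by (rule has_integral_eq[rotated]) (use p x in \<open>auto simp: power_0_left\<close>)
qed

text \<open>The remainder functional applied to x \<mapsto>
  \<open>pos (x - s) ^ (p - 1) / fact (p - 1)\<close>, with the integral already evaluated for s in
  [0, 1].\<close>

definition peano_kernel :: "nat \<Rightarrow> nat \<Rightarrow> (nat \<Rightarrow> real) \<Rightarrow> (nat \<Rightarrow> real) \<Rightarrow> real \<Rightarrow> real" where
  "peano_kernel p n a \<tau> s =
     (1 - s) ^ p / fact p - (\<Sum>i\<le>n. a i * (pos (\<tau> i - s) ^ (p - 1) / fact (p - 1)))"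

text \<open>Peano's theorem: the integral and all point values are expanded by Taylor's formula at
  0, and exactness on degrees below p cancels the Taylor polynomials.\<close>

theorem has_integral_peano_kernel:
  fixes Df :: "nat \<Rightarrow> real \<Rightarrow> real"
  assumes D: "\<And>m s. m < p \<Longrightarrow> s \<in> {0..1} \<Longrightarrow>
      (Df m has_real_derivative Df (Suc m) s) (at s within {0..1})"
    and p: "2 \<le> p"
    and \<tau>: "\<And>i. i \<le> n \<Longrightarrow> \<tau> i \<in> {0..1}"
    and exact: "\<And>j. j < p \<Longrightarrow> (\<Sum>i\<le>n. a i * \<tau> i ^ j) = 1 / real (Suc j)"
  shows "((\<lambda>s. peano_kernel p n a \<tau> s * Df p s) has_integral
      (integral {0..1} (Df 0) - (\<Sum>i\<le>n. a i * Df 0 (\<tau> i)))) {0..1}"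
proof -
  \<comment> \<open>Prepending the antiderivative of \<open>Df 0\<close> to the chain turns the
    integral into the point value of \<open>F 0\<close> at 1, so the same Taylor lemma applies with
    order p + 1.\<close>
  define F where "F m = (case m of 0 \<Rightarrow> \<lambda>x. integral {0..x} (Df 0) | Suc k \<Rightarrow> Df k)" for m
  have cont: "continuous_on {0..1} (Df 0)"
    using D[of 0] p by (intro DERIV_continuous_on[of _ _ "Df 1"]) auto
  have "((\<lambda>s. pos (1 - s) ^ (Suc p - 1) / fact (Suc p - 1) * F (Suc p) s) has_integral
      (F 0 1 - (\<Sum>j<Suc p. 1 ^ j / fact j * F j 0))) {0..1}"
  proof (rule has_integral_Taylor_remainder_01)
    show "(F m has_real_derivative F (Suc m) s) (at s within {0..1})"
      if "m < Suc p" "s \<in> {0..1}" for m s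
      using that D[of "m - 1" s] integral_has_vector_derivative[OF cont, of s]
      by (cases m) (auto simp: F_def has_real_derivative_iff_has_vector_derivative)
  qed (use p in auto)
  moreover have "F 0 1 - (\<Sum>j<Suc p. 1 ^ j / fact j * F j 0) =
      integral {0..1} (Df 0) - (\<Sum>j<p. Df j 0 / fact (Suc j))"
    unfolding sum.lessThan_Suc_shift by (simp add: F_def)
  moreover have "F (Suc p) = Df p" by (simp add: F_def)
  ultimately have I: "((\<lambda>s. pos (1 - s) ^ p / fact p * Df p s) has_integral
      (integral {0..1} (Df 0) - (\<Sum>j<p. Df j 0 / fact (Suc j)))) {0..1}"
    by (simp only: diff_Suc_1)
  have Q: "((\<lambda>s. \<Sum>i\<le>n. a i * (pos (\<tau> i - s) ^ (p - 1) / fact (p - 1) * Df p s)) has_integral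
      (\<Sum>i\<le>n. a i * (Df 0 (\<tau> i) - (\<Sum>j<p. \<tau> i ^ j / fact j * Df j 0)))) {0..1}"
    by (intro has_integral_sum has_integral_mult_right has_integral_Taylor_remainder_01)
      (use D p \<tau> in auto)
  have "(\<Sum>i\<le>n. a i * (\<Sum>j<p. \<tau> i ^ j / fact j * Df j 0)) =
      (\<Sum>i\<le>n. \<Sum>j<p. a i * \<tau> i ^ j * (Df j 0 / fact j))"
    by (simp add: sum_distrib_left field_simps)
  also have "\<dots> = (\<Sum>j<p. (\<Sum>i\<le>n. a i * \<tau> i ^ j) * (Df j 0 / fact j))"
    by (subst sum.swap) (simp only: sum_distrib_right)
  also have "\<dots> = (\<Sum>j<p. Df j 0 / fact (Suc j))"
    by (intro sum.cong refl) (simp add: exact field_simps)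
  finally have T: "(\<Sum>i\<le>n. a i * (\<Sum>j<p. \<tau> i ^ j / fact j * Df j 0)) = (\<Sum>j<p. Df j 0 / fact (Suc j))" .
  have K: "((\<lambda>s. pos (1 - s) ^ p / fact p * Df p s -
        (\<Sum>i\<le>n. a i * (pos (\<tau> i - s) ^ (p - 1) / fact (p - 1) * Df p s))) has_integral
      (integral {0..1} (Df 0) - (\<Sum>j<p. Df j 0 / fact (Suc j)) -
       (\<Sum>i\<le>n. a i * (Df 0 (\<tau> i) - (\<Sum>j<p. \<tau> i ^ j / fact j * Df j 0))))) {0..1}"
    by (rule has_integral_diff[OF I Q])
  have R: "integral {0..1} (Df 0) - (\<Sum>j<p. Df j 0 / fact (Suc j)) -
       (\<Sum>i\<le>n. a i * (Df 0 (\<tau> i) - (\<Sum>j<p. \<tau> i ^ j / fact j * Df j 0))) =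
      integral {0..1} (Df 0) - (\<Sum>i\<le>n. a i * Df 0 (\<tau> i))"
    unfolding right_diff_distrib sum_subtractf T by simp
  have eq: "pos (1 - s) ^ p / fact p * Df p s -
        (\<Sum>i\<le>n. a i * (pos (\<tau> i - s) ^ (p - 1) / fact (p - 1) * Df p s)) =
      peano_kernel p n a \<tau> s * Df p s" if "s \<in> {0..1}" for s
    using that by (simp add: peano_kernel_def left_diff_distrib sum_distrib_right mult.assoc)
  show ?thesis
    by (rule has_integral_eq[OF _ K[unfolded R]]) (rule eq)
qed

text \<open>The derivatives of x^p / p!, the test function whose p-th derivative is 1.\<close>

lemma DERIV_monomial_chain:
  assumes "m < p"
  shows "((\<lambda>x::real. x ^ (p - m) / fact (p - m)) has_real_derivative
    x ^ (p - Suc m) / fact (p - Suc m)) (at x within S)"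
proof -
  define q where "q = p - Suc m"
  have q: "p - m = Suc q" "p - Suc m = q" using assms by (auto simp: q_def)
  show ?thesis
    unfolding q using DERIV_cdivide[OF DERIV_pow[of "Suc q" x S], of "fact (Suc q)"]
    by (simp del: of_nat_Suc)
qed

text \<open>\<open>\<sigma>\<close> carries the sign of the kernel. The remainder is then at most M
  times the integral of the signed kernel, and this integral is found by inserting x^p / p! into
  Peano's formula.\<close>

corollary peano_kernel_nonneg_bounds:
  fixes Df :: "nat \<Rightarrow> real \<Rightarrow> real"
  assumes D: "\<And>m s. m < p \<Longrightarrow> s \<in> {0..1} \<Longrightarrow>
      (Df m has_real_derivative Df (Suc m) s) (at s within {0..1})"
    and p: "2 \<le> p"
    and \<tau>: "\<And>i. i \<le> n \<Longrightarrow> \<tau> i \<in> {0..1}"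
    and exact: "\<And>j. j < p \<Longrightarrow> (\<Sum>i\<le>n. a i * \<tau> i ^ j) = 1 / real (Suc j)"
    and \<sigma>: "\<And>s. s \<in> {0..1} \<Longrightarrow> 0 \<le> \<sigma> * peano_kernel p n a \<tau> s"
    and M: "\<And>s. s \<in> {0..1} \<Longrightarrow> 0 \<le> Df p s \<and> Df p s \<le> M"
  shows "0 \<le> \<sigma> * (integral {0..1} (Df 0) - (\<Sum>i\<le>n. a i * Df 0 (\<tau> i)))"
    and "\<sigma> * (integral {0..1} (Df 0) - (\<Sum>i\<le>n. a i * Df 0 (\<tau> i))) \<le>
      \<sigma> * (1 / fact (Suc p) - (\<Sum>i\<le>n. a i * \<tau> i ^ p) / fact p) * M"
proof -
  have f: "((\<lambda>s. \<sigma> * (peano_kernel p n a \<tau> s * Df p s)) has_integral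
      \<sigma> * (integral {0..1} (Df 0) - (\<Sum>i\<le>n. a i * Df 0 (\<tau> i)))) {0..1}"
    by (intro has_integral_mult_right has_integral_peano_kernel) (use D p \<tau> exact in auto)
  have "((\<lambda>s. \<sigma> * (peano_kernel p n a \<tau> s * (s ^ (p - p) / fact (p - p)))) has_integral
      \<sigma> * (integral {0..1} (\<lambda>s. s ^ (p - 0) / fact (p - 0)) - (\<Sum>i\<le>n. a i * (\<tau> i ^ (p - 0) / fact (p - 0))))) {0..1}"
    by (rule has_integral_mult_right, rule has_integral_peano_kernel[where Df = "\<lambda>j s. s ^ (p - j) / fact (p - j)"])
      (use DERIV_monomial_chain p \<tau> exact in auto)
  moreover have "integral {0..1} (\<lambda>s::real. s ^ p / fact p) = 1 / fact (Suc p)"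
    by (rule integral_unique) (use has_integral_divide[OF has_integral_power_01[of p], of "fact p"] in simp)
  ultimately have "((\<lambda>s. \<sigma> * peano_kernel p n a \<tau> s) has_integral
      \<sigma> * (1 / fact (Suc p) - (\<Sum>i\<le>n. a i * \<tau> i ^ p) / fact p)) {0..1}"
    by (simp add: sum_divide_distrib)
  note g = has_integral_mult_left[OF this, of M]
  show "0 \<le> \<sigma> * (integral {0..1} (Df 0) - (\<Sum>i\<le>n. a i * Df 0 (\<tau> i)))"
    by (rule has_integral_nonneg[OF f]) (use \<sigma> M in \<open>simp add: mult.assoc[symmetric]\<close>)
  show "\<sigma> * (integral {0..1} (Df 0) - (\<Sum>i\<le>n. a i * Df 0 (\<tau> i))) \<le>
      \<sigma> * (1 / fact (Suc p) - (\<Sum>i\<le>n. a i * \<tau> i ^ p) / fact p) * M"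
    by (rule has_integral_le[OF f g]) (use \<sigma> M in \<open>simp add: mult.assoc[symmetric] mult_left_mono\<close>)
qed

text \<open>The formula transported to [0, n]: the knots are integers, and nodes and weights are
  both multiplied by n. Exactness is kept only as moments of monomials and truncated powers. The
  weak bound on the last node admits Radau as well as Gauss formulae.\<close>

locale spline_quadrature =
  fixes n r :: nat and b t :: "nat \<Rightarrow> real"
  assumes n_pos: "0 < n"
    and strict_mono: "strict_mono_on {..n} t"
    and first_pos: "0 < t 0"
    and last_le: "t n \<le> real n"
    and moment: "p < r \<Longrightarrow> (\<Sum>i\<le>n. b i * t i ^ p) = real n ^ Suc p / real (Suc p)"
    and moment_right: "r - 2 \<le> p \<Longrightarrow> p < r \<Longrightarrow> k \<le> n \<Longrightarrow>
      (\<Sum>i\<le>n. b i * pos (t i - real k) ^ p) = (real n - real k) ^ Suc p / real (Suc p)"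
    and moment_left: "r - 2 \<le> p \<Longrightarrow> p < r \<Longrightarrow> k \<le> n \<Longrightarrow>
      (\<Sum>i\<le>n. b i * pos (real k - t i) ^ p) = real k ^ Suc p / real (Suc p)"
begin

definition kernel :: "real \<Rightarrow> real" where
  "kernel s = (real n - s) ^ r / fact r - (\<Sum>i\<le>n. b i * (pos (t i - s) ^ (r - 1) / fact (r - 1)))"

lemma node_less: "i < j \<Longrightarrow> j \<le> n \<Longrightarrow> t i < t j"
  using strict_mono by (auto simp: strict_mono_on_def)

lemma node_le: "i \<le> j \<Longrightarrow> j \<le> n \<Longrightarrow> t i \<le> t j"
  using node_less[of i j] by (cases "i = j") auto

lemma node_bounds: "i \<le> n \<Longrightarrow> 0 < t i \<and> t i \<le> real n"
  using node_le[of 0 i] node_le[of i n] first_pos last_le by auto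

end

text \<open>Rescaling gives every moment the factor n^(p + 1): n from the weight and n^p from the
  homogeneous test function.\<close>

lemma spline_quadrature_scaled:
  assumes n: "0 < n" and r: "r \<in> {3, 4}"
    and \<tau>: "strict_mono_on {..n} \<tau>" "0 < \<tau> 0" "\<tau> n \<le> 1"
    and exact: "\<forall>f\<in>spline_space n r. remainder (quad (n + 1) a \<tau>) f = 0"
  shows "spline_quadrature n r (\<lambda>i. real n * a i) (\<lambda>i. real n * \<tau> i)"
proof
  have Q: "(\<Sum>i\<le>n. a i * f (\<tau> i)) = I" if "f \<in> spline_space n r" "(f has_integral I) {0..1}" for f I
    using that exact by (auto simp: remainder_def quad_def lessThan_Suc_atMost integral_unique)
  show "(\<Sum>i\<le>n. real n * a i * (real n * \<tau> i) ^ p) = real n ^ Suc p / real (Suc p)"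
    if "p < r" for p
  proof -
    have "(\<Sum>i\<le>n. real n * a i * (real n * \<tau> i) ^ p) = real n ^ Suc p * (\<Sum>i\<le>n. a i * \<tau> i ^ p)"
      by (simp add: sum_distrib_left power_mult_distrib mult_ac)
    then show ?thesis
      using Q[OF power_in_spline_space[OF r that] has_integral_power_01] by simp
  qed
  fix p k assume p: "r - 2 \<le> p" "p < r" and k: "k \<le> n"
  \<comment> \<open>The integrals of truncated powers are stated for exponents \<open>Suc q\<close>;
    p is positive because r \<ge> 3.\<close>
  define q where "q = p - 1"
  have q: "p = Suc q" using p r by (auto simp: q_def)
  have "(\<Sum>i\<le>n. real n * a i * pos (real n * \<tau> i - real k) ^ p) =
      real n ^ Suc p * (\<Sum>i\<le>n. a i * pos (\<tau> i - real k / real n) ^ p)"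
  proof -
    have scale: "pos (real n * x - real k) = real n * pos (x - real k / real n)" for x
      using n pos_mult[of "real n" "x - real k / real n"] by (simp add: right_diff_distrib)
    show ?thesis
      unfolding scale by (simp add: sum_distrib_left power_mult_distrib mult_ac)
  qed
  also have "(\<Sum>i\<le>n. a i * pos (\<tau> i - real k / real n) ^ p) = (1 - real k / real n) ^ (q + 2) / real (q + 2)"
    using Q[OF pos_power_in_spline_space(1)[OF r p, of k]] has_integral_pos_diff_power[of "real k / real n" q] n k
    by (simp add: q)
  also have "real n ^ Suc p * \<dots> = (real n * (1 - real k / real n)) ^ Suc p / real (Suc p)"
    unfolding q power_mult_distrib by simp
  also have "real n * (1 - real k / real n) = real n - real k"
    using n by (simp add: right_diff_distrib)
  finally show "(\<Sum>i\<le>n. real n * a i * pos (real n * \<tau> i - real k) ^ p) =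
      (real n - real k) ^ Suc p / real (Suc p)" .
  have "(\<Sum>i\<le>n. real n * a i * pos (real k - real n * \<tau> i) ^ p) =
      real n ^ Suc p * (\<Sum>i\<le>n. a i * pos (real k / real n - \<tau> i) ^ p)"
  proof -
    have scale: "pos (real k - real n * x) = real n * pos (real k / real n - x)" for x
      using n pos_mult[of "real n" "real k / real n - x"] by (simp add: right_diff_distrib)
    show ?thesis
      unfolding scale by (simp add: sum_distrib_left power_mult_distrib mult_ac)
  qed
  also have "(\<Sum>i\<le>n. a i * pos (real k / real n - \<tau> i) ^ p) = (real k / real n) ^ (q + 2) / real (q + 2)"
    using Q[OF pos_power_in_spline_space(2)[OF r p, of k]] has_integral_pos_diff_power'[of "real k / real n" q] n k
    by (simp add: q)
  also have "real n ^ Suc p * \<dots> = (real n * (real k / real n)) ^ Suc p / real (Suc p)"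
    unfolding q power_mult_distrib by simp
  also have "real n * (real k / real n) = real k"
    using n by simp
  finally show "(\<Sum>i\<le>n. real n * a i * pos (real k - real n * \<tau> i) ^ p) = real k ^ Suc p / real (Suc p)" .
qed (use assms in \<open>auto simp: strict_mono_on_def mult_le_cancel_left1\<close>)

text \<open>Rescaling costs only the positive factor n^r, so the sign of the kernel can be studied
  on [0, n].\<close>

lemma peano_kernel_eq_scaled:
  assumes "spline_quadrature n r (\<lambda>i. real n * a i) (\<lambda>i. real n * \<tau> i)" "2 \<le> r"
  shows "real n ^ r * peano_kernel r n a \<tau> s =
    spline_quadrature.kernel n r (\<lambda>i. real n * a i) (\<lambda>i. real n * \<tau> i) (real n * s)"
proof -
  interpret spline_quadrature n r "\<lambda>i. real n * a i" "\<lambda>i. real n * \<tau> i" by fact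
  obtain q where q: "r = Suc q" using assms(2) by (cases r) auto
  have scale: "pos (real n * x - real n * s) = real n * pos (x - s)" for x
    using pos_mult[of "real n" "x - s"] by (simp add: right_diff_distrib)
  have n: "real n - real n * s = real n * (1 - s)" by (simp add: right_diff_distrib)
  show ?thesis
    unfolding kernel_def peano_kernel_def
    unfolding scale n q diff_Suc_1 right_diff_distrib[of "real n ^ Suc q"]
      sum_distrib_left power_mult_distrib
    by (simp add: mult_ac)
qed

section \<open>Radau formulae\<close>

text \<open>On cell m only the knots 1, ..., m contribute. The end point u = 1 is included because
  knot m + 1 contributes \<open>pos 0 ^ p\<close>, which is 0 for positive p.\<close>

lemma sum_pos_shift:
  assumes "m < n" "0 \<le> u" "u \<le> 1" "0 < p"
  shows "(\<Sum>j\<in>{1..<n}. pos (real m + u - real j) ^ p) = (\<Sum>j<m. (real j + u) ^ p)"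
proof -
  have "(\<Sum>j\<in>{1..<n}. pos (real m + u - real j) ^ p) = (\<Sum>j\<in>{1..m}. pos (real m + u - real j) ^ p)"
  proof (rule sum.mono_neutral_right)
    show "\<forall>j\<in>{1..<n} - {1..m}. pos (real m + u - real j) ^ p = 0"
    proof
      fix j assume "j \<in> {1..<n} - {1..m}"
      then have "real m + 1 \<le> real j" by auto
      then show "pos (real m + u - real j) ^ p = 0" using assms by simp
    qed
  qed (use assms in auto)
  also have "\<dots> = (\<Sum>j<m. (real j + u) ^ p)"
    by (rule sum.reindex_bij_witness[where i = "\<lambda>j. m - j" and j = "\<lambda>j. m - j"])
      (use assms in \<open>auto simp: of_nat_diff algebra_simps\<close>)
  finally show ?thesis .
qed

text \<open>Telescoping with the Bernoulli polynomial B_3(x) = x (x - 1/2) (x - 1), since B_3(x + 1)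
  - B_3(x) = 3 x^2.\<close>

lemma sum_shifted_squares:
  "3 * (\<Sum>j<m. (real j + u) ^ 2) =
    (real m + u) ^ 3 - 3 / 2 * (real m + u) ^ 2 + (real m + u) / 2 - u * (u - 1 / 2) * (u - 1)"
proof (induction m)
  case 0
  show ?case by (simp add: field_simps power2_eq_square power3_eq_cube)
next
  case (Suc m)
  have "3 * (\<Sum>j<Suc m. (real j + u) ^ 2) = 3 * (\<Sum>j<m. (real j + u) ^ 2) + 3 * (real m + u) ^ 2"
    by simp
  then show ?case
    unfolding Suc.IH by (simp add: field_simps power2_eq_square power3_eq_cube)
qed

text \<open>The same with B_4, whose constant term cancels; without it B_4(u) is the bubble u^2 (1 -
  u)^2.\<close>

lemma sum_shifted_cubes:
  "4 * (\<Sum>j<m. (real j + u) ^ 3) =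
    (real m + u) ^ 4 - 2 * (real m + u) ^ 3 + (real m + u) ^ 2 - u ^ 2 * (1 - u) ^ 2"
proof (induction m)
  case 0
  show ?case by (simp add: algebra_simps power2_eq_square power3_eq_cube power4_eq_xxxx)
next
  case (Suc m)
  have "4 * (\<Sum>j<Suc m. (real j + u) ^ 3) = 4 * (\<Sum>j<m. (real j + u) ^ 3) + 4 * (real m + u) ^ 3"
    by simp
  then show ?case
    unfolding Suc.IH by (simp add: algebra_simps power2_eq_square power3_eq_cube power4_eq_xxxx)
qed

text \<open>The right-hand side is B_5(m + 1) / 5, and B_5(1) = 0.\<close>

lemma sum_shifted_fourth_powers:
  "(\<Sum>j<m. (real j + 1) ^ 4) =
    (real m + 1) ^ 5 / 5 - (real m + 1) ^ 4 / 2 + (real m + 1) ^ 3 / 3 - (real m + 1) / 30"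
proof (induction m)
  case (Suc m)
  have "(\<Sum>j<Suc m. (real j + 1) ^ 4) = (\<Sum>j<m. (real j + 1) ^ 4) + (real m + 1) ^ 4"
    by simp
  then show ?case
    unfolding Suc.IH by (simp add: field_simps eval_nat_numeral)
qed simp

text \<open>Cells are closed on both sides so that x = n finds a place in the last one.\<close>

lemma unit_cell_decomposition:
  assumes "0 \<le> x" "x \<le> real n" "0 < n"
  obtains m u where "m < n" "0 \<le> u" "u \<le> 1" "x = real m + u"
proof (cases "x = real n")
  case True
  then show ?thesis using assms by (intro that[of "n - 1" 1]) (auto simp: of_nat_diff)
next
  case False
  define m where "m = nat \<lfloor>x\<rfloor>"
  have m: "real m = real_of_int \<lfloor>x\<rfloor>" using assms by (simp add: m_def)
  show ?thesis
  proof (rule that[of m "x - real m"])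
    have "real m < real n" using m assms False by linarith
    then show "m < n" by simp
  qed (use m in linarith)+
qed

text \<open>The terms at c + 1 cancel the parabola beyond its cell. In this form its quadrature sum
  can be read off from \<open>moment_right\<close>.\<close>

lemma bubble_eq:
  fixes x c :: real
  shows "pos (x - c) - pos (x - c) ^ 2 + pos (x - (c + 1)) + pos (x - (c + 1)) ^ 2 =
    (if c < x \<and> x < c + 1 then (x - c) * (1 - (x - c)) else 0)"
proof -
  consider "x \<le> c" | "c < x" "x < c + 1" | "c + 1 \<le> x" by linarith
  then show ?thesis by cases (auto simp: power2_eq_square algebra_simps)
qed

text \<open>A second difference of truncated first powers is a hat, here with peak 1 at c +
  1.\<close>

lemma hat_eq:
  fixes x c :: real
  shows "pos (x - c) - 2 * pos (x - (c + 1)) + pos (x - (c + 2)) =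
    (if c < x \<and> x < c + 1 then x - c else if c + 1 \<le> x \<and> x < c + 2 then 1 - (x - (c + 1)) else 0)"
proof -
  consider "x \<le> c" | "c < x" "x < c + 1" | "c + 1 \<le> x" "x < c + 2" | "c + 2 \<le> x" by linarith
  then show ?thesis by cases auto
qed

section \<open>Location of the Radau nodes\<close>

locale radau = spline_quadrature n 3 b t for n b t +
  assumes last_eq: "t n = real n"
begin

lemma weighted_bubble:
  assumes "k < n"
  shows "(\<Sum>i\<le>n. b i * (if real k < t i \<and> t i < real k + 1 then (t i - real k) * (1 - (t i - real k)) else 0)) = 1 / 6"
proof -
  have "(\<Sum>i\<le>n. b i * (if real k < t i \<and> t i < real k + 1 then (t i - real k) * (1 - (t i - real k)) else 0)) =
    (\<Sum>i\<le>n. b i * pos (t i - real k) ^ 1) - (\<Sum>i\<le>n. b i * pos (t i - real k) ^ 2) +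
    (\<Sum>i\<le>n. b i * pos (t i - real (Suc k)) ^ 1) + (\<Sum>i\<le>n. b i * pos (t i - real (Suc k)) ^ 2)"
    unfolding bubble_eq[symmetric] by (simp add: sum.distrib sum_subtractf algebra_simps)
  also have "\<dots> = (real n - real k) ^ 2 / 2 - (real n - real k) ^ 3 / 3 +
      (real n - real (Suc k)) ^ 2 / 2 + (real n - real (Suc k)) ^ 3 / 3"
    using assms moment_right[of 1 k] moment_right[of 2 k] moment_right[of 1 "Suc k"] moment_right[of 2 "Suc k"]
    by (simp add: numeral_2_eq_2 numeral_3_eq_3)
  also have "\<dots> = 1 / 6"
    by (simp add: field_simps power2_eq_square power3_eq_cube)
  finally show ?thesis .
qed

text \<open>Without a node inside the cell, the quadrature sum of its bubble would vanish instead of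
  being 1 / 6. The last node sits at n and thus in no open cell.\<close>

lemma node_in_cell:
  assumes "k < n"
  obtains i where "i < n" "real k < t i" "t i < real k + 1"
proof -
  obtain i where i: "i \<le> n" "real k < t i" "t i < real k + 1"
  proof (rule ccontr)
    assume "\<not> thesis"
    with that have "(\<Sum>i\<le>n. b i * (if real k < t i \<and> t i < real k + 1 then (t i - real k) * (1 - (t i - real k)) else 0)) = 0"
      by (intro sum.neutral) auto
    with weighted_bubble[OF assms] show False by simp
  qed
  moreover have "i \<noteq> n"
    using i assms last_eq by auto
  ultimately show ?thesis using that[of i] by simp
qed

text \<open>Picking a node for each of the n cells gives a strictly increasing map of {0, ..., n -
  1} into itself, hence the identity. Upward induction yields one inequality, downward induction
  from n - 1 the other.\<close>

lemma node_location:
  assumes "k < n"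
  shows "real k < t k \<and> t k < real k + 1"
proof -
  obtain f where f: "\<And>k. k < n \<Longrightarrow> f k < n \<and> real k < t (f k) \<and> t (f k) < real k + 1"
  proof -
    have "\<exists>i. k < n \<longrightarrow> i < n \<and> real k < t i \<and> t i < real k + 1" for k
      by (cases "k < n") (auto elim: node_in_cell)
    then show ?thesis using that by metis
  qed
  have step: "f k < f (Suc k)" if "Suc k < n" for k
  proof (rule ccontr)
    assume "\<not> f k < f (Suc k)"
    then have "t (f (Suc k)) \<le> t (f k)"
      using f[of k] that by (intro node_le) auto
    then show False using f[of k] f[of "Suc k"] that by auto
  qed
  have "k \<le> f k" if "k < n" for k
    using that
  proof (induction k)
    case (Suc k)
    then show ?case using step[of k] by simp
  qed simp
  moreover have "f k \<le> k"
  proof -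
    have "f (n - 1 - j) \<le> n - 1 - j" if "j < n" for j
      using that
    proof (induction j)
      case 0
      have "f (n - 1) < n" using f[of "n - 1"] n_pos by auto
      then show ?case by simp
    next
      case (Suc j)
      then show ?case using step[of "n - 1 - Suc j"] by (simp add: Suc_diff_Suc)
    qed
    from this[of "n - 1 - k"] show ?thesis using assms by simp
  qed
  ultimately have "f k = k" using assms by (simp add: le_antisym)
  then show ?thesis using f[OF assms] by simp
qed

section \<open>Weights and recursion of the Radau nodes\<close>

definition \<theta> :: "nat \<Rightarrow> real" where "\<theta> k = t k - real k"

lemma theta_bounds: "k < n \<Longrightarrow> 0 < \<theta> k" "k < n \<Longrightarrow> \<theta> k < 1"
  using node_location[of k] by (auto simp: \<theta>_def)

lemma node_lower: "i \<le> n \<Longrightarrow> real i \<le> t i"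
  using node_location[of i] last_eq by (cases "i = n") auto

lemma node_upper: "i < k \<Longrightarrow> k \<le> n \<Longrightarrow> t i < real k"
  using node_location[of i] by (simp add: Suc_le_eq[symmetric])

lemma in_cell_iff:
  assumes "i \<le> n" "k < n"
  shows "real k < t i \<and> t i < real k + 1 \<longleftrightarrow> i = k"
proof (cases i k rule: linorder_cases)
  case less
  then show ?thesis using node_upper[of i k] assms by auto
next
  case equal
  then show ?thesis using node_location[of k] assms by auto
next
  case greater
  then show ?thesis using node_lower[of i] assms by auto
qed

text \<open>Node k is the only one in the support of the bubble of cell k.\<close>

lemma weight: "k < n \<Longrightarrow> b k * (\<theta> k * (1 - \<theta> k)) = 1 / 6"
proof -
  assume k: "k < n"
  have "1 / 6 = (\<Sum>i\<le>n. if i = k then b i * (\<theta> i * (1 - \<theta> i)) else 0)"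
    unfolding weighted_bubble[OF k, symmetric]
    by (intro sum.cong refl) (use k in \<open>simp add: in_cell_iff \<theta>_def\<close>)
  then show ?thesis using k by simp
qed

text \<open>The test function \<open>pos (1 - x)\<close> sees node 0 alone; comparison with
  \<open>weight\<close> eliminates \<open>b 0\<close>.\<close>

lemma theta_0: "\<theta> 0 = 1 / 3"
proof -
  have "(\<Sum>i\<le>n. b i * pos (real 1 - t i) ^ 1) = 1 / 2"
    using moment_left[of 1 1] n_pos by simp
  moreover have "(\<Sum>i\<le>n. b i * pos (real 1 - t i) ^ 1) = (\<Sum>i\<le>n. if i = 0 then b 0 * (1 - \<theta> 0) else 0)"
  proof (intro sum.cong refl)
    fix i assume "i \<in> {..n}"
    then show "b i * pos (real 1 - t i) ^ 1 = (if i = 0 then b 0 * (1 - \<theta> 0) else 0)"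
      using node_lower[of i] node_location[of 0] n_pos by (cases i) (auto simp: \<theta>_def)
  qed
  ultimately have "b 0 * (1 - \<theta> 0) = 1 / 2" by simp
  moreover have "(b 0 * (1 - \<theta> 0)) * \<theta> 0 = 1 / 6"
    using weight[of 0] n_pos by (simp add: mult_ac)
  ultimately have "1 / 2 * \<theta> 0 = 1 / 6" by (simp only:)
  then show ?thesis by simp
qed

text \<open>The hat with peak at knot k + 1 sees only the nodes k and k + 1. Eliminating their
  weights leaves 1 / (6 (1 - \<theta> k)) + 1 / (6 \<theta> (k + 1)) = 1.\<close>

lemma theta_Suc:
  assumes "Suc k < n"
  shows "\<theta> (Suc k) = (1 - \<theta> k) / (5 - 6 * \<theta> k)"
proof -
  have "(\<Sum>i\<le>n. b i * (pos (t i - real k) - 2 * pos (t i - (real k + 1)) + pos (t i - (real k + 2)))) =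
    (\<Sum>i\<le>n. b i * pos (t i - real k) ^ 1) - 2 * (\<Sum>i\<le>n. b i * pos (t i - real (Suc k)) ^ 1) +
    (\<Sum>i\<le>n. b i * pos (t i - real (Suc (Suc k))) ^ 1)"
    by (simp add: sum.distrib sum_subtractf sum_distrib_left algebra_simps)
  also have "\<dots> = (real n - real k) ^ 2 / 2 - 2 * ((real n - real (Suc k)) ^ 2 / 2) +
      (real n - real (Suc (Suc k))) ^ 2 / 2"
    using assms moment_right[of 1 k] moment_right[of 1 "Suc k"] moment_right[of 1 "Suc (Suc k)"]
    by (simp add: numeral_2_eq_2)
  also have "\<dots> = 1"
    by (simp add: field_simps power2_eq_square)
  finally have "1 = (\<Sum>i\<le>n. b i * (pos (t i - real k) - 2 * pos (t i - (real k + 1)) + pos (t i - (real k + 2))))" ..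
  also have "\<dots> = (\<Sum>i\<le>n. (if i = k then b k * \<theta> k else 0) + (if i = Suc k then b (Suc k) * (1 - \<theta> (Suc k)) else 0))"
  proof (intro sum.cong refl)
    fix i assume "i \<in> {..n}"
    then show "b i * (pos (t i - real k) - 2 * pos (t i - (real k + 1)) + pos (t i - (real k + 2))) =
        (if i = k then b k * \<theta> k else 0) + (if i = Suc k then b (Suc k) * (1 - \<theta> (Suc k)) else 0)"
      using in_cell_iff[of i k] in_cell_iff[of i "Suc k"] node_lower[of "Suc k"] node_location[of "Suc k"]
        node_lower[of i] node_upper[of i "Suc k"] assms
      unfolding hat_eq by (auto simp: \<theta>_def)
  qed
  also have "\<dots> = b k * \<theta> k + b (Suc k) * (1 - \<theta> (Suc k))"
    using assms by (simp add: sum.distrib)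
  finally have sum: "b k * \<theta> k + b (Suc k) * (1 - \<theta> (Suc k)) = 1" ..
  have k: "k < n" using assms by simp
  have "1 - \<theta> k \<noteq> 0" "\<theta> (Suc k) \<noteq> 0"
    using theta_bounds(2)[OF k] theta_bounds(1)[OF assms] by auto
  then have "b k * \<theta> k = 1 / (6 * (1 - \<theta> k))" "b (Suc k) * (1 - \<theta> (Suc k)) = 1 / (6 * \<theta> (Suc k))"
    using weight[OF k] weight[OF assms] by (auto simp: field_simps)
  with sum have "1 / (6 * (1 - \<theta> k)) + 1 / (6 * \<theta> (Suc k)) = 1" by simp
  with \<open>1 - \<theta> k \<noteq> 0\<close> \<open>\<theta> (Suc k) \<noteq> 0\<close>
  have eq: "\<theta> (Suc k) * (5 - 6 * \<theta> k) = 1 - \<theta> k"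
    by (simp add: field_simps)
  then have "5 - 6 * \<theta> k \<noteq> 0" using \<open>1 - \<theta> k \<noteq> 0\<close> by auto
  then show ?thesis using eq by (simp add: field_simps)
qed

text \<open>For \<theta> k \<le> 1/3 the denominator of the recursion is positive, and 3 (1 -
  \<theta> k) \<le> 5 - 6 \<theta> k amounts to \<theta> k \<le> 2/3.\<close>

lemma theta_le: "k < n \<Longrightarrow> \<theta> k \<le> 1 / 3"
proof (induction k)
  case 0
  show ?case by (simp add: theta_0)
next
  case (Suc k)
  then show ?case by (simp add: theta_Suc field_simps)
qed

lemma theta_ge: "k < n \<Longrightarrow> (3 - sqrt 3) / 6 \<le> \<theta> k"
proof (induction k)
  case 0
  have "1 \<le> sqrt 3" by simp
  then show ?case by (simp add: theta_0)
next
  case (Suc k)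
  \<comment> \<open>z is the smaller fixed point of the recursion. The factorization below shows
    that a step stays on the upper side of z, as 6 z \<ge> 1.\<close>
  define z :: real where "z = (3 - sqrt 3) / 6"
  have z: "6 * z ^ 2 = 6 * z - 1"
    by (simp add: z_def power2_eq_square field_simps)
  have pos: "0 < 5 - 6 * \<theta> k" using theta_le[of k] Suc.prems by simp
  have "sqrt 3 \<le> 2" by (rule real_le_lsqrt) auto
  then have "0 \<le> (\<theta> k - z) * (6 * z - 1)"
    using Suc by (intro mult_nonneg_nonneg) (auto simp: z_def)
  also have "\<dots> = 1 - \<theta> k - z * (5 - 6 * \<theta> k)"
    using z by (simp add: algebra_simps power2_eq_square)
  finally have "z * (5 - 6 * \<theta> k) \<le> 1 - \<theta> k" by simp
  then show ?case
    using Suc.prems pos by (simp add: theta_Suc z_def[symmetric] pos_le_divide_eq)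
qed

text \<open>Up to a quadratic spline, x^3 is B_3(u) with u the position inside the cell, and B_3 has
  integral 0 over a cell. The remainder is therefore minus the quadrature sum of B_3(u), to which
  \<open>weight\<close> applies.\<close>

lemma third_moment:
  "real n ^ 4 / 4 - (\<Sum>i\<le>n. b i * t i ^ 3) = (\<Sum>k<n. (\<theta> k - 1 / 2) / 6)"
proof -
  \<comment> \<open>The last node has u = 1, where B_3 vanishes.\<close>
  define \<beta> where "\<beta> i = (if i = n then 0 else \<theta> i * (\<theta> i - 1 / 2) * (\<theta> i - 1))" for i
  have node: "t i ^ 3 = 3 / 2 * t i ^ 2 - t i / 2 + 3 * (\<Sum>j\<in>{1..<n}. pos (t i - real j) ^ 2) + \<beta> i"
    if "i \<le> n" for i
  proof -
    obtain m u where mu: "m < n" "0 \<le> u" "u \<le> 1" "t i = real m + u" "\<beta> i = u * (u - 1 / 2) * (u - 1)"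
    proof (cases "i = n")
      case True
      then show ?thesis
        using n_pos last_eq by (intro that[of "n - 1" 1]) (auto simp: \<beta>_def of_nat_diff)
    next
      case False
      then show ?thesis
        using theta_bounds[of i] \<open>i \<le> n\<close> by (intro that[of i "\<theta> i"]) (auto simp: \<beta>_def \<theta>_def)
    qed
    then show ?thesis
      using sum_pos_shift[OF mu(1-3), of 2] sum_shifted_squares[where m = m and u = u] by simp
  qed
  have moments: "(\<Sum>i\<le>n. b i * t i) = real n ^ 2 / 2" "(\<Sum>i\<le>n. b i * t i ^ 2) = real n ^ 3 / 3"
    using moment[of 1] moment[of 2] by (simp_all add: numeral_2_eq_2 numeral_3_eq_3)
  have "(\<Sum>i\<le>n. b i * (\<Sum>j\<in>{1..<n}. pos (t i - real j) ^ 2)) =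
      (\<Sum>j\<in>{1..<n}. \<Sum>i\<le>n. b i * pos (t i - real j) ^ 2)"
    by (simp only: sum_distrib_left) (rule sum.swap)
  also have "\<dots> = (\<Sum>j\<in>{1..<n}. (real n - real j) ^ 3 / 3)"
    using moment_right[of 2] by (intro sum.cong refl) (simp add: numeral_3_eq_3)
  \<comment> \<open>n is written as the right end u = 1 of the last cell to match
    \<open>sum_pos_shift\<close>.\<close>
  also have "\<dots> = (\<Sum>j\<in>{1..<n}. pos (real (n - 1) + 1 - real j) ^ 3) / 3"
    unfolding sum_divide_distrib using n_pos by (intro sum.cong refl) (auto simp: of_nat_diff)
  also have "\<dots> = (\<Sum>j<n - 1. (real j + 1) ^ 3) / 3"
    using n_pos by (subst sum_pos_shift) auto
  also have "\<dots> = (real n ^ 4 - 2 * real n ^ 3 + real n ^ 2) / 12"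
    using sum_shifted_cubes[where m = "n - 1" and u = 1] n_pos by (simp add: of_nat_diff)
  finally have squares: "(\<Sum>i\<le>n. b i * (\<Sum>j\<in>{1..<n}. pos (t i - real j) ^ 2)) =
      (real n ^ 4 - 2 * real n ^ 3 + real n ^ 2) / 12" .
  define A where "A = (\<Sum>k<n. (\<theta> k - 1 / 2) / 6)"
  have "(\<Sum>i\<le>n. b i * \<beta> i) = (\<Sum>i<n. b i * \<beta> i)"
    by (simp add: lessThan_Suc_atMost[symmetric] \<beta>_def)
  also have "\<dots> = (\<Sum>k<n. - ((\<theta> k - 1 / 2) / 6))"
  proof (intro sum.cong refl)
    fix k assume "k \<in> {..<n}"
    then have "b k * \<beta> k = - ((\<theta> k - 1 / 2) * (b k * (\<theta> k * (1 - \<theta> k))))"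
      by (simp add: \<beta>_def field_simps)
    then show "b k * \<beta> k = - ((\<theta> k - 1 / 2) / 6)"
      using \<open>k \<in> {..<n}\<close> by (simp add: weight)
  qed
  finally have bubbles: "(\<Sum>i\<le>n. b i * \<beta> i) = - A"
    by (simp only: sum_negf A_def)
  have "(\<Sum>i\<le>n. b i * t i ^ 3) =
      (\<Sum>i\<le>n. 3 / 2 * (b i * t i ^ 2) - (b i * t i) / 2
        + 3 * (b i * (\<Sum>j\<in>{1..<n}. pos (t i - real j) ^ 2)) + b i * \<beta> i)"
    by (intro sum.cong refl, subst node) (auto simp: algebra_simps)
  also have "\<dots> = 3 / 2 * (real n ^ 3 / 3) - (real n ^ 2 / 2) / 2
      + 3 * ((real n ^ 4 - 2 * real n ^ 3 + real n ^ 2) / 12) - A"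
    unfolding sum.distrib sum_subtractf sum_distrib_left[symmetric] sum_divide_distrib[symmetric]
    by (simp only: moments squares bubbles)
  also have "\<dots> = real n ^ 4 / 4 - A"
    by (simp add: field_simps)
  finally show ?thesis
    unfolding A_def by (simp only: diff_diff_eq2 add_diff_cancel_left')
qed

text \<open>As z - 1/2 = - sqrt 3 / 6, the fixed point alone yields the main term, and the sum T of
  all \<theta> k - z contributes - T / 36. The summands are nonnegative, so the first four give a
  lower bound for T.\<close>

lemma third_moment_bound:
  assumes "4 \<le> n"
  shows "- (real n ^ 4 / 4 - (\<Sum>i\<le>n. b i * t i ^ 3)) / 6 \<le> sqrt 3 * real n / 216 - 1 / 269.14"
proof -
  define z :: real where "z = (3 - sqrt 3) / 6"
  have th1: "\<theta> (Suc 0) = 2 / 9"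
    using assms by (subst theta_Suc) (auto simp: theta_0)
  have th2: "\<theta> (Suc (Suc 0)) = 7 / 33"
    using assms by (subst theta_Suc) (auto simp: th1)
  have "\<theta> (Suc (Suc (Suc 0))) = 26 / 123"
    using assms by (subst theta_Suc) (auto simp: th2)
  then have "(\<Sum>k<4. \<theta> k - z) = 1 / 3 + 2 / 9 + 7 / 33 + 26 / 123 - 4 * z"
    by (simp add: eval_nat_numeral theta_0 th1 th2)
  \<comment> \<open>The margin in the next estimate is below 10^(-7), hence the seven
    decimals.\<close>
  moreover have "1.7320508 \<le> sqrt 3" by (rule real_le_rsqrt) (simp add: power2_eq_square)
  \<comment> \<open>This constant is 36 / 269.14.\<close>
  ultimately have "1800 / 13457 \<le> (\<Sum>k<4. \<theta> k - z)"
    unfolding z_def by (simp add: field_simps)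
  also have "\<dots> \<le> (\<Sum>k<n. \<theta> k - z)"
    using assms theta_ge by (intro sum_mono2) (auto simp: z_def)
  finally have "1800 / 13457 \<le> (\<Sum>k<n. \<theta> k - z)" .
  moreover have "(\<Sum>k<n. (\<theta> k - 1 / 2) / 6) = ((\<Sum>k<n. \<theta> k - z) - sqrt 3 * real n / 6) / 6"
    unfolding sum_divide_distrib[symmetric] sum_subtractf sum_constant card_lessThan
    by (simp add: z_def field_simps)
  moreover have "- S / 6 \<le> x / 216 - 1 / 269.14"
    if "1800 / 13457 \<le> T" "S = (T - x / 6) / 6" for S T x :: real
    using that by (simp add: field_simps)
  ultimately show ?thesis
    unfolding third_moment by blast
qed

text \<open>On a cell the kernel is an explicit cubic on either side of the node, with a parameter d
  fixed by the zero at the left knot. The bound \<theta> \<le> 1/3 decides the sign.\<close>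

lemma kernel_nonpos:
  assumes "0 \<le> s" "s \<le> real n"
  shows "kernel s \<le> 0"
proof -
  obtain m u where mu: "m < n" "0 \<le> u" "u \<le> 1" "s = real m + u"
    using unit_cell_decomposition[OF assms n_pos] by metis
  \<comment> \<open>W is the total weight of the nodes to the right of cell m, and d its excess over
    the length of the interval that remains there.\<close>
  define W where "W = (\<Sum>i\<le>n. if m < i then b i else 0)"
  define d where "d = W - (real n - real (Suc m))"
  have cell: "(\<Sum>i\<le>n. b i * pos (t i - (real m + v)) ^ 2) = (real n - (real m + v)) ^ 3 / 3
      - (1 - v) ^ 3 / 3 + d * (1 - v) ^ 2 + b m * pos (\<theta> m - v) ^ 2"
    if v: "0 \<le> v" "v \<le> 1" for v
  proof -
    \<comment> \<open>For nodes beyond the cell, t i - (m + v) is split into t i - (m + 1) and 1 - v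
      before squaring.\<close>
    have node: "pos (t i - (real m + v)) ^ 2 = pos (t i - real (Suc m)) ^ 2 + 2 * (1 - v) * pos (t i - real (Suc m)) ^ 1
        + (if m < i then (1 - v) ^ 2 else 0) + (if i = m then pos (\<theta> m - v) ^ 2 else 0)" if "i \<le> n" for i
    proof (cases i m rule: linorder_cases)
      case less
      then show ?thesis using node_upper[of i m] mu(1) v by simp
    next
      case equal
      then show ?thesis using node_location[OF mu(1)] by (simp add: \<theta>_def algebra_simps)
    next
      case greater
      then have "real (Suc m) \<le> t i" using node_lower[OF that] by auto
      then show ?thesis using greater v by (simp add: power2_eq_square algebra_simps)
    qed
    have "(\<Sum>i\<le>n. b i * pos (t i - (real m + v)) ^ 2) =
      (\<Sum>i\<le>n. b i * pos (t i - real (Suc m)) ^ 2 + 2 * (1 - v) * (b i * pos (t i - real (Suc m)) ^ 1)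
        + (1 - v) ^ 2 * (if m < i then b i else 0) + (if i = m then b m * pos (\<theta> m - v) ^ 2 else 0))"
      by (intro sum.cong refl, subst node) (auto simp: algebra_simps)
    also have "\<dots> = (\<Sum>i\<le>n. b i * pos (t i - real (Suc m)) ^ 2)
        + 2 * (1 - v) * (\<Sum>i\<le>n. b i * pos (t i - real (Suc m)) ^ 1)
        + (1 - v) ^ 2 * W + b m * pos (\<theta> m - v) ^ 2"
      using mu(1) by (simp add: sum.distrib sum_distrib_left W_def)
    also have "\<dots> = (real n - real (Suc m)) ^ 3 / 3 + 2 * (1 - v) * ((real n - real (Suc m)) ^ 2 / 2)
        + (1 - v) ^ 2 * W + b m * pos (\<theta> m - v) ^ 2"
    proof -
      have "(\<Sum>i\<le>n. b i * pos (t i - real (Suc m)) ^ 1) = (real n - real (Suc m)) ^ 2 / 2"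
        using moment_right[of 1 "Suc m"] mu(1) by (simp add: numeral_2_eq_2)
      moreover have "(\<Sum>i\<le>n. b i * pos (t i - real (Suc m)) ^ 2) = (real n - real (Suc m)) ^ 3 / 3"
        using moment_right[of 2 "Suc m"] mu(1) by (simp add: numeral_3_eq_3)
      ultimately show ?thesis by (simp only:)
    qed
    finally show ?thesis
      by (simp add: d_def field_simps power2_eq_square power3_eq_cube)
  qed
  define w where "w = 1 - \<theta> m"
  have th: "0 < \<theta> m" "\<theta> m \<le> 1 / 3" using theta_bounds[OF mu(1)] theta_le[OF mu(1)] by auto
  have w: "\<theta> m = 1 - w" "2 / 3 \<le> w" "w < 1" using th by (auto simp: w_def)
  have bw: "b m * ((1 - w) * w) = 1 / 6" using weight[OF mu(1)] w by simp
  \<comment> \<open>The case v = 0, where the kernel vanishes at the knot m.\<close>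
  have "d = 1 / 3 - b m * (1 - w) ^ 2"
    using cell[of 0] moment_right[of 2 m] mu(1) w by (simp add: numeral_3_eq_3)
  then have "6 * w * d = 6 * w * (1 / 3 - b m * (1 - w) ^ 2)"
    by (simp only:)
  also have "\<dots> = 2 * w - 6 * (b m * ((1 - w) * w)) * (1 - w)"
    by (simp add: power2_eq_square algebra_simps)
  finally have dw: "6 * w * d = 3 * w - 1"
    by (simp add: bw)
  have "kernel s = (1 - u) ^ 3 / 6 - d * (1 - u) ^ 2 / 2 - b m * pos (\<theta> m - u) ^ 2 / 2"
    using cell[OF mu(2,3)] by (simp add: kernel_def mu(4) sum_divide_distrib[symmetric] fact_numeral field_simps)
  also have "\<dots> \<le> 0"
  proof (cases "\<theta> m \<le> u")
    case True
    \<comment> \<open>After the node the kernel is (1 - u)^2 (1 - u - 3 d) / 6, so 1 - u \<le> 3 d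
      is wanted; it follows from 1 - u \<le> w and w^2 \<le> 3 d w.\<close>
    have "w * (1 - u) \<le> w * w" using True w by (intro mult_left_mono) auto
    also have "w * w \<le> (6 * w * d) / 2"
    proof -
      have "0 \<le> (2 * w - 1) * (1 - w)" using w by (intro mult_nonneg_nonneg) auto
      then show ?thesis unfolding dw by (simp add: algebra_simps)
    qed
    also have "\<dots> = w * (3 * d)" by simp
    finally have "w * (1 - u) \<le> w * (3 * d)" .
    then have "1 - u \<le> 3 * d" using w by simp
    then have "(1 - u) ^ 2 * (1 - u) \<le> (1 - u) ^ 2 * (3 * d)" by (intro mult_left_mono) auto
    moreover have "(1 - u) ^ 3 = (1 - u) ^ 2 * (1 - u)" by (simp add: power2_eq_square power3_eq_cube)
    ultimately have "(1 - u) ^ 3 \<le> 3 * (d * (1 - u) ^ 2)" by (simp only: mult_ac)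
    then show ?thesis using True by simp
  next
    case False
    define q where "q = (1 - u) ^ 3 / 6 - d * (1 - u) ^ 2 / 2 - b m * (\<theta> m - u) ^ 2 / 2"
    \<comment> \<open>Clearing the weight exposes the factor u^2 of the double zero at the knot; the
      cofactor has a sign because w \<ge> 2/3.\<close>
    have "12 * ((1 - w) * w) * q = 2 * (1 - w) * w * (1 - u) ^ 3 - (6 * w * d) * (1 - w) * (1 - u) ^ 2
        - 6 * (b m * ((1 - w) * w)) * ((1 - w) - u) ^ 2"
      by (simp add: q_def w(1) field_simps power2_eq_square power3_eq_cube)
    also have "\<dots> = - (2 * (1 - w) * w * u ^ 3 + w * (3 * w - 2) * u ^ 2)"
      unfolding dw bw by (simp add: algebra_simps power2_eq_square power3_eq_cube)
    also have "\<dots> \<le> 0"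
    proof -
      have "0 \<le> 2 * (1 - w) * w * u ^ 3" "0 \<le> w * (3 * w - 2) * u ^ 2"
        using w mu by auto
      then show ?thesis by linarith
    qed
    finally have "q \<le> 0"
      using w by (simp add: mult_le_0_iff)
    then show ?thesis using False by (simp add: q_def)
  qed
  finally show ?thesis .
qed

end

section \<open>Gauss formulae\<close>

text \<open>This is the shape of \<open>kernel2\<close> between consecutive nodes: two zeros
  determine it, and their sum will give the partial sums of the weights.\<close>

lemma quadratic_eq_factored:
  fixes \<alpha> \<beta> :: real
  assumes "p ^ 2 / 2 - \<alpha> * p + \<beta> = 0" "q ^ 2 / 2 - \<alpha> * q + \<beta> = 0" "p \<noteq> q"
  shows "2 * \<alpha> = p + q" "s ^ 2 / 2 - \<alpha> * s + \<beta> = (s - p) * (s - q) / 2"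
proof -
  have "(p - q) * (p + q - 2 * \<alpha>) = 0"
    using assms(1,2) by (simp add: algebra_simps power2_eq_square)
  with assms(3) show \<alpha>: "2 * \<alpha> = p + q" by simp
  have "\<beta> = (2 * \<alpha>) * p / 2 - p ^ 2 / 2" using assms(1) by simp
  then have \<beta>: "\<beta> = p * q / 2" unfolding \<alpha> by (simp add: field_simps power2_eq_square)
  have "s ^ 2 / 2 - \<alpha> * s + \<beta> = s ^ 2 / 2 - (2 * \<alpha>) * s / 2 + \<beta>" by simp
  also have "\<dots> = (s - p) * (s - q) / 2"
    unfolding \<alpha> \<beta> by (simp add: field_simps power2_eq_square)
  finally show "s ^ 2 / 2 - \<alpha> * s + \<beta> = (s - p) * (s - q) / 2" .
qed

text \<open>The coefficients are chosen such that the bubble minus \<open>corner_spline\<close> has double zeros at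
  \<open>1/4\<close> and \<open>1 + 3/92\<close>, the first two nodes of the scaled Gauss formula.\<close>

definition corner_spline :: "real \<Rightarrow> real" where
  "corner_spline x = 399 / 529 * pos (1 - x) ^ 2 - 296 / 529 * pos (1 - x) ^ 3
     + 543 / 8464 * pos (2 - x) ^ 2 - 3 / 46 * pos (2 - x) ^ 3"

lemma corner_spline_eq_0: "2 \<le> x \<Longrightarrow> corner_spline x = 0"
  by (simp add: corner_spline_def)

text \<open>On the first cell the difference is a square times a quadratic with positive
  coefficients, on the second a square. Here v is the distance to the right end of the cell.\<close>

lemma corner_spline_le_bubble:
  assumes "0 \<le> u" "u \<le> 1"
  shows "corner_spline (real m + u) \<le> u ^ 2 * (1 - u) ^ 2"
proof -
  define v where "v = 1 - u"
  have v: "u = 1 - v" "0 \<le> v" using assms by (auto simp: v_def)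
  consider "m = 0" | "m = 1" | "2 \<le> m" by linarith
  then show ?thesis
  proof cases
    case 1
    have "u ^ 2 * (1 - u) ^ 2 - corner_spline (real m + u) = (3 / 4 - v) ^ 2 * (v ^ 2 + 66 / 529 * v + 1 / 529)"
    proof -
      have p: "pos (1 - (real m + u)) = v" "pos (2 - (real m + u)) = 1 + v"
        using 1 v by auto
      show ?thesis
        unfolding corner_spline_def p
        unfolding v(1)
        by (simp add: field_simps power2_eq_square power3_eq_cube)
    qed
    moreover have "0 \<le> \<dots>" using v by simp
    ultimately show ?thesis by linarith
  next
    case 2
    have "u ^ 2 * (1 - u) ^ 2 - corner_spline (real m + u) = v ^ 2 * (89 / 92 - v) ^ 2"
    proof -
      have p: "pos (1 - (real m + u)) = 0" "pos (2 - (real m + u)) = v"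
        using 2 v assms by auto
      show ?thesis
        unfolding corner_spline_def p
        unfolding v(1)
        by (simp add: field_simps power2_eq_square power3_eq_cube)
    qed
    moreover have "0 \<le> \<dots>" by simp
    ultimately show ?thesis by linarith
  next
    case 3
    then show ?thesis using assms by (simp add: corner_spline_eq_0)
  qed
qed

text \<open>For n \<ge> 4 the supports [0, 2] and [n - 2, n] do not overlap, so at most one summand
  is nonzero at a time. Reflection exchanges the two ends and preserves the bubble.\<close>

lemma corner_splines_le_bubble:
  assumes "4 \<le> n" "m < n" "0 \<le> u" "u \<le> 1"
  shows "corner_spline (real m + u) + corner_spline (real n - (real m + u)) \<le> u ^ 2 * (1 - u) ^ 2"
proof (cases "m \<le> 1")
  case True
  then have "real m \<le> 1" "4 \<le> real n" using assms by auto
  then have "2 \<le> real n - (real m + u)" using assms by linarith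
  then show ?thesis using corner_spline_le_bubble[OF assms(3,4)] by (simp add: corner_spline_eq_0)
next
  case False
  then have "2 \<le> real m + u" using assms by auto
  moreover have eq: "real n - (real m + u) = real (n - 1 - m) + (1 - u)"
    using assms by (simp add: of_nat_diff)
  have "corner_spline (real n - (real m + u)) \<le> (1 - u) ^ 2 * (1 - (1 - u)) ^ 2"
    unfolding eq using assms by (intro corner_spline_le_bubble) auto
  ultimately show ?thesis
    by (simp add: corner_spline_eq_0 mult.commute)
qed

section \<open>Interlacing of kernel zeros and Gauss nodes; positive weights\<close>

locale gauss = spline_quadrature n 4 b t for n b t +
  assumes last_less: "t n < real n"
begin

text \<open>Minus the derivative of \<open>kernel\<close>; \<open>kernel2\<close> is minus the
  derivative of this, hence the second derivative of \<open>kernel\<close>.\<close>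

definition kernel1 :: "real \<Rightarrow> real" where
  "kernel1 s = (real n - s) ^ 3 / 6 - (\<Sum>i\<le>n. b i * (pos (t i - s) ^ 2 / 2))"

definition kernel2 :: "real \<Rightarrow> real" where
  "kernel2 s = (real n - s) ^ 2 / 2 - (\<Sum>i\<le>n. b i * pos (t i - s))"

lemma DERIV_kernel: "(kernel has_real_derivative - kernel1 s) (at s)"
proof -
  have d: "((\<lambda>s. pos (c - s) ^ 3) has_real_derivative - (3 * pos (c - s) ^ 2)) (at s)" for c
    using DERIV_pos_diff_power'[of c 1 s] by (simp add: eval_nat_numeral)
  have "((\<lambda>s. (real n - s) ^ 4 / fact 4 - (\<Sum>i\<le>n. b i * (pos (t i - s) ^ 3 / fact 3)))
      has_real_derivative - (4 * (real n - s) ^ 3) / fact 4 - (\<Sum>i\<le>n. b i * (- (3 * pos (t i - s) ^ 2) / fact 3))) (at s)"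
    by (intro DERIV_diff DERIV_sum DERIV_cmult DERIV_cdivide d) (auto intro!: derivative_eq_intros)
  moreover have "- (4 * (real n - s) ^ 3) / fact 4 - (\<Sum>i\<le>n. b i * (- (3 * pos (t i - s) ^ 2) / fact 3)) = - kernel1 s"
    by (simp add: kernel1_def fact_numeral sum_negf)
  ultimately show ?thesis
    by (simp add: kernel_def[abs_def])
qed

lemma DERIV_kernel1: "(kernel1 has_real_derivative - kernel2 s) (at s)"
proof -
  have d: "((\<lambda>s. pos (c - s) ^ 2) has_real_derivative - (2 * pos (c - s))) (at s)" for c
    using DERIV_pos_diff_power'[of c 0 s] by (simp add: eval_nat_numeral)
  have "((\<lambda>s. (real n - s) ^ 3 / 6 - (\<Sum>i\<le>n. b i * (pos (t i - s) ^ 2 / 2)))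
      has_real_derivative - (3 * (real n - s) ^ 2) / 6 - (\<Sum>i\<le>n. b i * (- (2 * pos (t i - s)) / 2))) (at s)"
    by (intro DERIV_diff DERIV_sum DERIV_cmult DERIV_cdivide d) (auto intro!: derivative_eq_intros)
  moreover have "- (3 * (real n - s) ^ 2) / 6 - (\<Sum>i\<le>n. b i * (- (2 * pos (t i - s)) / 2)) = - kernel2 s"
    by (simp add: kernel2_def sum_negf)
  ultimately show ?thesis
    by (simp add: kernel1_def[abs_def])
qed

text \<open>Exactness on truncated cubes gives this zero; truncated squares will make it a double
  one.\<close>

lemma kernel_knot: "k \<le> n \<Longrightarrow> kernel (real k) = 0"
  using moment_right[of 3 k]
  by (simp add: kernel_def sum_divide_distrib[symmetric] fact_numeral)

lemma kernel1_knot: "k \<le> n \<Longrightarrow> kernel1 (real k) = 0"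
  using moment_right[of 2 k]
  by (simp add: kernel1_def sum_divide_distrib[symmetric])

text \<open>Up to the constant n, this is the linear coefficient of \<open>kernel2\<close> on the
  interval that ends at node i, so a weight is the jump of this coefficient at its node.\<close>

definition tail_weight :: "nat \<Rightarrow> real" where
  "tail_weight i = (\<Sum>j\<le>n. if i \<le> j then b j else 0)"

lemma tail_weight_diff: "i \<le> n \<Longrightarrow> tail_weight i - tail_weight (Suc i) = b i"
proof -
  assume i: "i \<le> n"
  have "tail_weight i - tail_weight (Suc i) = (\<Sum>j\<le>n. if j = i then b i else 0)"
    unfolding tail_weight_def sum_subtractf[symmetric] by (intro sum.cong refl) auto
  then show ?thesis using i by simp
qed

text \<open>The case i = 0 covers the region left of all nodes.\<close>

lemma kernel2_between:
  assumes "\<And>j. j < i \<Longrightarrow> j \<le> n \<Longrightarrow> t j \<le> s" "\<And>j. i \<le> j \<Longrightarrow> j \<le> n \<Longrightarrow> s \<le> t j"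
  shows "kernel2 s = s ^ 2 / 2 - (real n - tail_weight i) * s
    + (real n ^ 2 / 2 - (\<Sum>j\<le>n. if i \<le> j then b j * t j else 0))"
proof -
  have "(\<Sum>j\<le>n. b j * pos (t j - s)) = (\<Sum>j\<le>n. (if i \<le> j then b j * t j else 0) - (if i \<le> j then b j else 0) * s)"
    using assms by (intro sum.cong refl) (auto simp: algebra_simps not_le)
  also have "\<dots> = (\<Sum>j\<le>n. if i \<le> j then b j * t j else 0) - tail_weight i * s"
    unfolding sum_subtractf sum_distrib_right[symmetric] tail_weight_def ..
  finally show ?thesis
    by (simp add: kernel2_def field_simps power2_eq_square)
qed

lemma kernel2_cell:
  assumes "i < n" "t i \<le> s" "s \<le> t (Suc i)"
  shows "kernel2 s = s ^ 2 / 2 - (real n - tail_weight (Suc i)) * s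
    + (real n ^ 2 / 2 - (\<Sum>j\<le>n. if Suc i \<le> j then b j * t j else 0))"
proof (rule kernel2_between)
  show "t j \<le> s" if "j < Suc i" "j \<le> n" for j
    using node_le[of j i] that assms by simp
  show "s \<le> t j" if "Suc i \<le> j" "j \<le> n" for j
    using node_le[of "Suc i" j] that assms by simp
qed

lemma tail_weight_0: "tail_weight 0 = real n"
  using moment[of 0] by (simp add: tail_weight_def)

lemma kernel2_left:
  assumes "s \<le> t 0"
  shows "kernel2 s = s ^ 2 / 2"
proof -
  have "s \<le> t j" if "j \<le> n" for j
    using node_le[of 0 j] that assms by simp
  then show ?thesis
    using kernel2_between[of 0 s] moment[of 1] by (simp add: tail_weight_0 numeral_2_eq_2)
qed

lemma kernel2_right:
  assumes "t n \<le> s"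
  shows "kernel2 s = (real n - s) ^ 2 / 2"
proof -
  have "pos (t j - s) = 0" if "j \<le> n" for j
    using node_le[of j n] that assms by simp
  then show ?thesis by (simp add: kernel2_def)
qed

lemma kernel2_cell_factored:
  assumes "i < n" "t i \<le> p" "p < q" "q \<le> t (Suc i)" "kernel2 p = 0" "kernel2 q = 0"
  shows "2 * (real n - tail_weight (Suc i)) = p + q"
    and "t i \<le> s \<Longrightarrow> s \<le> t (Suc i) \<Longrightarrow> kernel2 s = (s - p) * (s - q) / 2"
proof -
  note f = quadratic_eq_factored[where p = p and q = q and \<alpha> = "real n - tail_weight (Suc i)"
      and \<beta> = "real n ^ 2 / 2 - (\<Sum>j\<le>n. if Suc i \<le> j then b j * t j else 0)"]
  have p: "p ^ 2 / 2 - (real n - tail_weight (Suc i)) * p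
    + (real n ^ 2 / 2 - (\<Sum>j\<le>n. if Suc i \<le> j then b j * t j else 0)) = 0"
    using kernel2_cell[of i p] assms by simp
  have q: "q ^ 2 / 2 - (real n - tail_weight (Suc i)) * q
    + (real n ^ 2 / 2 - (\<Sum>j\<le>n. if Suc i \<le> j then b j * t j else 0)) = 0"
    using kernel2_cell[of i q] assms by simp
  have pq: "p \<noteq> q" using assms by simp
  show "2 * (real n - tail_weight (Suc i)) = p + q"
    by (rule f(1)[OF p q pq])
  show "kernel2 s = (s - p) * (s - q) / 2" if "t i \<le> s" "s \<le> t (Suc i)"
    unfolding kernel2_cell[OF assms(1) that] by (rule f(2)[OF p q pq])
qed

text \<open>Between two nodes \<open>kernel2\<close> is a quadratic with leading coefficient
  1/2.\<close>

lemma no_three_zeros: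
  assumes "i < n" "t i \<le> p" "p < q" "q < r" "r \<le> t (Suc i)"
    and "kernel2 p = 0" "kernel2 q = 0" "kernel2 r = 0"
  shows False
  using kernel2_cell_factored(2)[of i p q r] assms by auto

text \<open>Rolle's theorem for \<open>kernel\<close> gives an inner zero of \<open>kernel1\<close>.
  Since \<open>kernel1\<close> also vanishes at both knots, Rolle's theorem on either side of that
  zero gives the two points.\<close>

lemma two_zeros_in_cell:
  assumes "k < n"
  shows "\<exists>y z. real k < y \<and> y < z \<and> z < real (Suc k) \<and> kernel2 y = 0 \<and> kernel2 z = 0"
proof -
  have rolle: "\<exists>\<xi>. x < \<xi> \<and> \<xi> < y \<and> f' \<xi> = 0"
    if xy: "x < y" and eq: "f x = f y" and f: "\<And>s. (f has_real_derivative - f' s) (at s)"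
    for f f' :: "real \<Rightarrow> real" and x y
  proof -
    have "continuous_on {x..y} f"
      by (rule DERIV_continuous_on) (rule has_field_derivative_at_within[OF f])
    moreover have "f differentiable (at s)" for s
      using f[of s] by (auto simp: real_differentiable_def)
    ultimately obtain \<xi> where "x < \<xi>" "\<xi> < y" "(f has_real_derivative 0) (at \<xi>)"
      using Rolle[OF xy eq] by blast
    moreover from this(3) have "- f' \<xi> = 0" by (rule DERIV_unique[OF f])
    ultimately show ?thesis by auto
  qed
  obtain \<xi> where \<xi>: "real k < \<xi>" "\<xi> < real (Suc k)" "kernel1 \<xi> = 0"
    using rolle[OF _ _ DERIV_kernel, of "real k" "real (Suc k)"] kernel_knot[of k] kernel_knot[of "Suc k"] assms
    by auto
  obtain y where "real k < y" "y < \<xi>" "kernel2 y = 0"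
    using rolle[OF \<xi>(1) _ DERIV_kernel1] kernel1_knot[of k] \<xi> assms by auto
  moreover obtain z where "\<xi> < z" "z < real (Suc k)" "kernel2 z = 0"
    using rolle[OF \<xi>(2) _ DERIV_kernel1] kernel1_knot[of "Suc k"] \<xi> assms by auto
  ultimately show ?thesis using order.strict_trans by blast
qed

text \<open>One pair of zeros from Rolle's theorem is selected in each cell; z is chosen with y
  already fixed, so that both belong to the same pair.\<close>

definition y :: "nat \<Rightarrow> real" where
  "y k = (SOME y. \<exists>z. real k < y \<and> y < z \<and> z < real (Suc k) \<and> kernel2 y = 0 \<and> kernel2 z = 0)"

definition z :: "nat \<Rightarrow> real" where
  "z k = (SOME z. real k < y k \<and> y k < z \<and> z < real (Suc k) \<and> kernel2 (y k) = 0 \<and> kernel2 z = 0)"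

lemma yz:
  assumes "k < n"
  shows "real k < y k" "y k < z k" "z k < real (Suc k)" "kernel2 (y k) = 0" "kernel2 (z k) = 0"
proof -
  have "\<exists>z. real k < y k \<and> y k < z \<and> z < real (Suc k) \<and> kernel2 (y k) = 0 \<and> kernel2 z = 0"
    unfolding y_def by (rule someI_ex) (rule two_zeros_in_cell[OF assms])
  then have "real k < y k \<and> y k < z k \<and> z k < real (Suc k) \<and> kernel2 (y k) = 0 \<and> kernel2 (z k) = 0"
    unfolding z_def by (rule someI_ex)
  then show "real k < y k" "y k < z k" "z k < real (Suc k)" "kernel2 (y k) = 0" "kernel2 (z k) = 0"
    by auto
qed

text \<open>Each of the \<open>n\<close> intervals between consecutive nodes carries at most two of the \<open>2n\<close> zeros
  found by Rolle's theorem, hence exactly two, in order.\<close>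

lemma node_less_y: "i < n \<Longrightarrow> t i < y i"
proof (induction i)
  case 0
  show ?case
  proof (rule ccontr)
    assume "\<not> t 0 < y 0"
    \<comment> \<open>Left of all nodes \<open>kernel2\<close> is s^2 / 2, which has no positive
      zero.\<close>
    then have "y 0 ^ 2 / 2 = 0" using kernel2_left[of "y 0"] yz(4)[OF 0] by simp
    then show False using yz(1)[OF 0] by simp
  qed
next
  case (Suc i)
  then have i: "i < n" by simp
  show ?case
  proof (rule ccontr)
    assume "\<not> t (Suc i) < y (Suc i)"
    \<comment> \<open>Otherwise y i, z i and y (i + 1) would be three zeros between the nodes i and
      i + 1.\<close>
    then show False
      using Suc i yz[OF i] yz[OF Suc.prems]
      by (intro no_three_zeros[of i "y i" "z i" "y (Suc i)"]) auto
  qed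
qed

text \<open>The mirror image, by induction from the last cell downwards: right of all nodes
  \<open>kernel2\<close> is (n - s)^2 / 2, which has no zero below n.\<close>

lemma z_less_node: "i < n \<Longrightarrow> z i < t (Suc i)"
proof -
  assume "i < n"
  then have "i \<le> n - 1" by simp
  then show ?thesis
  proof (induction rule: inc_induct)
    case base
    have n: "n - 1 < n" "Suc (n - 1) = n" using n_pos by auto
    show ?case
    proof (rule ccontr)
      assume "\<not> z (n - 1) < t (Suc (n - 1))"
      then have "(real n - z (n - 1)) ^ 2 / 2 = 0" using kernel2_right[of "z (n - 1)"] yz(5)[OF n(1)] n by simp
      then show False using yz(3)[OF n(1)] n by simp
    qed
  next
    case (step m)
    then have m: "m < n" "Suc m < n" by auto
    show ?case
    proof (rule ccontr)
      assume "\<not> z m < t (Suc m)"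
      then show False
        using step.IH m yz[OF m(1)] yz[OF m(2)]
        by (intro no_three_zeros[of "Suc m" "z m" "y (Suc m)" "z (Suc m)"]) auto
    qed
  qed
qed

lemma kernel2_factored:
  assumes "i < n" "t i \<le> s" "s \<le> t (Suc i)"
  shows "kernel2 s = (s - y i) * (s - z i) / 2"
  using kernel2_cell_factored(2)[OF assms(1), of "y i" "z i" s] node_less_y[of i] z_less_node[of i] yz[of i] assms
  by simp

lemma tail_weight_eq: "i < n \<Longrightarrow> 2 * (real n - tail_weight (Suc i)) = y i + z i"
  using kernel2_cell_factored(1)[of i "y i" "z i"] node_less_y[of i] z_less_node[of i] yz[of i] by simp

text \<open>The sum of the weights before node i is the midpoint of y (i - 1) and z (i - 1), which
  lies before t i, while the sum including node i is the midpoint of y i and z i, which lies after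
  it. At the two ends these sums are 0 and n.\<close>

lemma weight_pos:
  assumes "i \<le> n"
  shows "0 < b i"
proof -
  have "real n - tail_weight i < t i"
  proof (cases i)
    case 0
    then show ?thesis using first_pos by (simp add: tail_weight_0)
  next
    case (Suc j)
    then show ?thesis using tail_weight_eq[of j] z_less_node[of j] yz(2)[of j] assms by simp
  qed
  moreover have "t i < real n - tail_weight (Suc i)"
  proof (cases "i = n")
    case True
    then show ?thesis using last_less by (simp add: tail_weight_def)
  next
    case False
    then show ?thesis using tail_weight_eq[of i] node_less_y[of i] yz(2)[of i] assms by simp
  qed
  ultimately show ?thesis using tail_weight_diff[OF assms] by linarith
qed

section \<open>Sign pattern of \<open>kernel2\<close> on a cell and nonnegativity of the Gauss
  kernel\<close>

lemma kernel2_nonneg_left: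
  assumes "k < n" "real k \<le> s" "s \<le> y k"
  shows "0 \<le> kernel2 s"
proof (cases "s \<le> t k")
  case True
  show ?thesis
  proof (cases k)
    case 0
    then show ?thesis using True by (simp add: kernel2_left)
  next
    case (Suc j)
    \<comment> \<open>Here s has not yet reached node k, so the previous factorization applies, to
      the right of both of its zeros.\<close>
    then have j: "j < n" "z j < s" using yz(3)[of j] assms by auto
    then have "kernel2 s = (s - y j) * (s - z j) / 2"
      using True Suc node_less_y[of j] yz(2)[of j] by (intro kernel2_factored) auto
    also have "\<dots> \<ge> 0"
      using j yz(2)[OF j(1)] by (intro divide_nonneg_pos mult_nonneg_nonneg) auto
    finally show ?thesis .
  qed
next
  case False
  then have "kernel2 s = (s - y k) * (s - z k) / 2"
    using assms z_less_node[of k] yz(2)[of k] by (intro kernel2_factored) auto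
  also have "\<dots> \<ge> 0"
    using assms yz(2)[of k] by (simp add: mult_nonpos_nonpos)
  finally show ?thesis .
qed

lemma kernel2_nonpos_mid:
  assumes "k < n" "y k \<le> s" "s \<le> z k"
  shows "kernel2 s \<le> 0"
proof -
  have "kernel2 s = (s - y k) * (s - z k) / 2"
    using assms z_less_node[of k] node_less_y[of k] by (intro kernel2_factored) auto
  also have "\<dots> \<le> 0"
    using assms by (intro divide_nonpos_pos mult_nonneg_nonpos) auto
  finally show ?thesis .
qed

lemma kernel2_nonneg_right:
  assumes "k < n" "z k \<le> s" "s \<le> real (Suc k)"
  shows "0 \<le> kernel2 s"
proof (cases "s \<le> t (Suc k)")
  case True
  then have "kernel2 s = (s - y k) * (s - z k) / 2"
    using assms node_less_y[of k] yz(2)[of k] by (intro kernel2_factored) auto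
  also have "\<dots> \<ge> 0"
    using assms yz(2)[OF assms(1)] by (intro divide_nonneg_pos mult_nonneg_nonneg) auto
  finally show ?thesis .
next
  case False
  show ?thesis
  proof (cases "Suc k = n")
    case True
    then show ?thesis using False by (simp add: kernel2_right)
  next
    case neq: False
    \<comment> \<open>Here s is already beyond node k + 1, so the next factorization applies, to the
      left of both of its zeros.\<close>
    then have k: "Suc k < n" using assms by simp
    then have "kernel2 s = (s - y (Suc k)) * (s - z (Suc k)) / 2"
      using False assms yz[of "Suc k"] z_less_node[of "Suc k"] by (intro kernel2_factored) auto
    also have "\<dots> \<ge> 0"
      using assms yz(1,2)[OF k] by (simp add: mult_nonpos_nonpos)
    finally show ?thesis .
  qed
qed

lemma kernel1_decreasing:
  assumes "p \<le> q" "\<And>s. p \<le> s \<Longrightarrow> s \<le> q \<Longrightarrow> 0 \<le> kernel2 s"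
  shows "kernel1 q \<le> kernel1 p"
  by (rule DERIV_nonpos_imp_nonincreasing[OF assms(1)])
    (intro exI conjI, rule DERIV_kernel1, use assms(2) in simp)

lemma kernel1_increasing:
  assumes "p \<le> q" "\<And>s. p \<le> s \<Longrightarrow> s \<le> q \<Longrightarrow> kernel2 s \<le> 0"
  shows "kernel1 p \<le> kernel1 q"
  by (rule DERIV_nonneg_imp_nondecreasing[OF assms(1)])
    (intro exI conjI, rule DERIV_kernel1, use assms(2) in simp)

lemma kernel_decreasing:
  assumes "p \<le> q" "\<And>s. p \<le> s \<Longrightarrow> s \<le> q \<Longrightarrow> 0 \<le> kernel1 s"
  shows "kernel q \<le> kernel p"
  by (rule DERIV_nonpos_imp_nonincreasing[OF assms(1)])
    (intro exI conjI, rule DERIV_kernel, use assms(2) in simp)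

lemma kernel_increasing:
  assumes "p \<le> q" "\<And>s. p \<le> s \<Longrightarrow> s \<le> q \<Longrightarrow> kernel1 s \<le> 0"
  shows "kernel p \<le> kernel q"
  by (rule DERIV_nonneg_imp_nondecreasing[OF assms(1)])
    (intro exI conjI, rule DERIV_kernel, use assms(2) in simp)

text \<open>On [k, y k] \<open>kernel1\<close> falls from 0, so \<open>kernel\<close> rises from 0;
  on [z k, k + 1] \<open>kernel1\<close> falls to 0, so \<open>kernel\<close> falls to 0. In between
  \<open>kernel1\<close> increases, so \<open>kernel\<close> first rises and then falls and is
  smallest at an end.\<close>

lemma kernel_nonneg:
  assumes "0 \<le> s" "s \<le> real n"
  shows "0 \<le> kernel s"
proof -
  obtain k u where ku: "k < n" "0 \<le> u" "u \<le> 1" "s = real k + u"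
    using unit_cell_decomposition[OF assms n_pos] by metis
  note yzk = yz[OF ku(1)]
  have left: "0 \<le> kernel s" if "real k \<le> s" "s \<le> y k" for s
  proof -
    have "kernel1 x \<le> kernel1 (real k)" if "real k \<le> x" "x \<le> s" for x
      using that \<open>s \<le> y k\<close> by (intro kernel1_decreasing kernel2_nonneg_left[OF ku(1)]) auto
    then have "kernel (real k) \<le> kernel s"
      using that ku(1) by (intro kernel_increasing) (auto simp: kernel1_knot)
    then show ?thesis using ku(1) by (simp add: kernel_knot)
  qed
  have right: "0 \<le> kernel s" if "z k \<le> s" "s \<le> real (Suc k)" for s
  proof -
    have "kernel1 (real (Suc k)) \<le> kernel1 x" if "s \<le> x" "x \<le> real (Suc k)" for x
      using that \<open>z k \<le> s\<close> by (intro kernel1_decreasing kernel2_nonneg_right[OF ku(1)]) auto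
    then have "kernel (real (Suc k)) \<le> kernel s"
      using that ku(1) kernel1_knot[of "Suc k"] by (intro kernel_decreasing) auto
    then show ?thesis using ku(1) kernel_knot[of "Suc k"] by simp
  qed
  consider "s \<le> y k" | "z k \<le> s" | "y k \<le> s" "s \<le> z k" by linarith
  then show ?thesis
  proof cases
    case 1
    then show ?thesis using ku by (intro left) auto
  next
    case 2
    then show ?thesis using ku by (intro right) auto
  next
    case 3
    show ?thesis
    proof (cases "kernel1 s \<le> 0")
      case True
      have "kernel1 x \<le> kernel1 s" if "y k \<le> x" "x \<le> s" for x
        using that 3 by (intro kernel1_increasing kernel2_nonpos_mid[OF ku(1)]) auto
      then have "kernel (y k) \<le> kernel s"
        using True 3 by (intro kernel_increasing) (auto intro: order_trans)
      then show ?thesis using left[of "y k"] yzk by simp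
    next
      case False
      have "0 \<le> kernel1 x" if "s \<le> x" "x \<le> z k" for x
      proof -
        have "kernel1 s \<le> kernel1 x"
          using that 3 by (intro kernel1_increasing kernel2_nonpos_mid[OF ku(1)]) auto
        then show ?thesis using False by simp
      qed
      then have "kernel (z k) \<le> kernel s"
        using 3 by (intro kernel_decreasing) auto
      then show ?thesis using right[of "z k"] yzk by simp
    qed
  qed
qed

text \<open>The remainder of x^4 equals that of the bubbles, whose integral is n / 30. Positive
  weights allow the quadrature sum of the bubbles to be replaced by the smaller one of the corner
  splines, each contributing its integral 1 / 46.\<close>

lemma fourth_moment_bound:
  assumes "4 \<le> n"
  shows "real n ^ 5 / 5 - (\<Sum>i\<le>n. b i * t i ^ 4) \<le> real n / 30 - 1 / 23"
proof -
  \<comment> \<open>By the B_4 identity, the terms before the corner splines equal t i ^ 4 minus the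
    bubble at t i.\<close>
  have node: "2 * t i ^ 3 - t i ^ 2 + 4 * (\<Sum>j\<in>{1..<n}. pos (t i - real j) ^ 3)
      + (corner_spline (t i) + corner_spline (real n - t i)) \<le> t i ^ 4"
    if i: "i \<le> n" for i
  proof -
    obtain m u where mu: "m < n" "0 \<le> u" "u \<le> 1" "t i = real m + u"
      by (rule unit_cell_decomposition[of "t i" n]) (use node_bounds[OF i] n_pos in auto)
    then show ?thesis
      using sum_pos_shift[OF mu(1-3), of 3] sum_shifted_cubes[where m = m and u = u]
        corner_splines_le_bubble[OF assms mu(1-3)] by simp
  qed
  have moments: "(\<Sum>i\<le>n. b i * t i ^ 2) = real n ^ 3 / 3" "(\<Sum>i\<le>n. b i * t i ^ 3) = real n ^ 4 / 4"
    using moment[of 2] moment[of 3] by (simp_all add: eval_nat_numeral)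
  have "(\<Sum>i\<le>n. b i * (\<Sum>j\<in>{1..<n}. pos (t i - real j) ^ 3)) =
      (\<Sum>j\<in>{1..<n}. \<Sum>i\<le>n. b i * pos (t i - real j) ^ 3)"
    by (simp only: sum_distrib_left) (rule sum.swap)
  also have "\<dots> = (\<Sum>j\<in>{1..<n}. pos (real (n - 1) + 1 - real j) ^ 4 / 4)"
    using moment_right[of 3] n_pos by (intro sum.cong refl) (auto simp: of_nat_diff eval_nat_numeral)
  also have "\<dots> = (\<Sum>j<n - 1. (real j + 1) ^ 4) / 4"
    unfolding sum_divide_distrib[symmetric] using n_pos by (subst sum_pos_shift) auto
  also have "\<dots> = (real n ^ 5 / 5 - real n ^ 4 / 2 + real n ^ 3 / 3 - real n / 30) / 4"
    using sum_shifted_fourth_powers[of "n - 1"] n_pos by (simp add: of_nat_diff)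
  finally have cubes: "(\<Sum>i\<le>n. b i * (\<Sum>j\<in>{1..<n}. pos (t i - real j) ^ 3)) =
      (real n ^ 5 / 5 - real n ^ 4 / 2 + real n ^ 3 / 3 - real n / 30) / 4" .
  have corner: "(\<Sum>i\<le>n. b i * (c1 * P i ^ 2 - c2 * P i ^ 3 + c3 * R i ^ 2 - c4 * R i ^ 3)) =
      c1 * (\<Sum>i\<le>n. b i * P i ^ 2) - c2 * (\<Sum>i\<le>n. b i * P i ^ 3) +
      c3 * (\<Sum>i\<le>n. b i * R i ^ 2) - c4 * (\<Sum>i\<le>n. b i * R i ^ 3)"
    for P R :: "nat \<Rightarrow> real" and c1 c2 c3 c4 :: real
    by (simp add: sum.distrib sum_subtractf sum_distrib_left algebra_simps)
  have left_moments: "(\<Sum>i\<le>n. b i * pos (1 - t i) ^ 2) = 1 / 3" "(\<Sum>i\<le>n. b i * pos (1 - t i) ^ 3) = 1 / 4"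
      "(\<Sum>i\<le>n. b i * pos (2 - t i) ^ 2) = 8 / 3" "(\<Sum>i\<le>n. b i * pos (2 - t i) ^ 3) = 4"
    using moment_left[of 2 1] moment_left[of 3 1] moment_left[of 2 2] moment_left[of 3 2] assms
    by simp_all
  have "(\<Sum>i\<le>n. b i * corner_spline (t i)) = 1 / 46"
    unfolding corner_spline_def corner left_moments by simp
  \<comment> \<open>Reflected at n / 2, the truncated powers at 1 and 2 become those at the knots n
    - 1 and n - 2.\<close>
  moreover have right_moments:
    "(\<Sum>i\<le>n. b i * pos (1 - (real n - t i)) ^ 2) = 1 / 3" "(\<Sum>i\<le>n. b i * pos (1 - (real n - t i)) ^ 3) = 1 / 4"
    "(\<Sum>i\<le>n. b i * pos (2 - (real n - t i)) ^ 2) = 8 / 3" "(\<Sum>i\<le>n. b i * pos (2 - (real n - t i)) ^ 3) = 4"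
    using moment_right[of 2 "n - 1"] moment_right[of 3 "n - 1"]
      moment_right[of 2 "n - 2"] moment_right[of 3 "n - 2"] assms
    by (simp_all add: of_nat_diff algebra_simps)
  then have "(\<Sum>i\<le>n. b i * corner_spline (real n - t i)) = 1 / 46"
    unfolding corner_spline_def corner right_moments by simp
  ultimately have corners: "(\<Sum>i\<le>n. b i * (corner_spline (t i) + corner_spline (real n - t i))) = 1 / 23"
    by (simp add: sum.distrib distrib_left)
  have "(\<Sum>i\<le>n. b i * (2 * t i ^ 3 - t i ^ 2 + 4 * (\<Sum>j\<in>{1..<n}. pos (t i - real j) ^ 3)
      + (corner_spline (t i) + corner_spline (real n - t i)))) \<le> (\<Sum>i\<le>n. b i * t i ^ 4)"
    using node weight_pos by (intro sum_mono mult_left_mono) (auto intro: less_imp_le)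
  also have "(\<Sum>i\<le>n. b i * (2 * t i ^ 3 - t i ^ 2 + 4 * (\<Sum>j\<in>{1..<n}. pos (t i - real j) ^ 3)
      + (corner_spline (t i) + corner_spline (real n - t i)))) =
      (\<Sum>i\<le>n. 2 * (b i * t i ^ 3) - b i * t i ^ 2 + 4 * (b i * (\<Sum>j\<in>{1..<n}. pos (t i - real j) ^ 3))
      + b i * (corner_spline (t i) + corner_spline (real n - t i)))"
    by (intro sum.cong refl) (simp add: distrib_left right_diff_distrib)
  also have "\<dots> = 2 * (real n ^ 4 / 4) - real n ^ 3 / 3
      + 4 * ((real n ^ 5 / 5 - real n ^ 4 / 2 + real n ^ 3 / 3 - real n / 30) / 4) + 1 / 23"
    unfolding sum.distrib sum_subtractf sum_distrib_left[symmetric]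
    by (simp only: moments cubes corners)
  also have "\<dots> = real n ^ 5 / 5 - real n / 30 + 1 / 23"
    by (simp add: field_simps)
  finally show ?thesis by linarith
qed

end

section \<open>Error bounds\<close>

lemma quad_exact_power:
  assumes "r \<in> {3, 4}" "p < r" "\<forall>f\<in>spline_space n r. remainder (quad (n + 1) a \<tau>) f = 0"
  shows "(\<Sum>i\<le>n. a i * \<tau> i ^ p) = 1 / real (Suc p)"
  using power_in_spline_space[OF assms(1,2), of n] assms(3) integral_unique[OF has_integral_power_01[of p]]
  by (auto simp: remainder_def quad_def lessThan_Suc_atMost)

lemma C01_has_real_derivative:
  assumes "f \<in> C01 k" "m < k" "s \<in> {0..1}"
  shows "(higher_deriv01 m f has_real_derivative higher_deriv01 (Suc m) f s) (at s within {0..1})"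
proof -
  have "higher_deriv01 m f differentiable (at s within {0..1})"
    using assms by (auto simp: C01_def differentiable_on_def)
  then show ?thesis
    by (simp add: vector_derivative_works has_real_derivative_iff_has_vector_derivative
        higher_deriv01_def deriv01_def)
qed

lemma le_supnorm01:
  assumes "continuous_on {0..1} g" "x \<in> {0..1}"
  shows "g x \<le> supnorm01 g"
proof -
  have "compact ((\<lambda>x. \<bar>g x\<bar>) ` {0..1})"
    using assms(1) by (intro compact_continuous_image continuous_intros) auto
  then have "\<bar>g x\<bar> \<le> supnorm01 g"
    unfolding supnorm01_def
    by (intro cSUP_upper assms(2) bounded_imp_bdd_above compact_imp_bounded)
  then show ?thesis by simp
qed

lemma integral_reflect_01:
  fixes f :: "real \<Rightarrow> real"
  assumes "continuous_on {0..1} f"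
  shows "integral {0..1} (\<lambda>x. f (1 - x)) = integral {0..1} f"
proof -
  have "(f has_integral integral {0..1} f) (cbox 0 1)"
    using integrable_continuous_real[OF assms] by (simp add: integrable_integral)
  from has_integral_affinity[OF this, of "-1" 1]
  have "((\<lambda>x. f (1 - x)) has_integral integral {0..1} f) ((\<lambda>x. 1 - x) ` {0..1})"
    by simp
  moreover have "(\<lambda>x::real. 1 - x) ` {0..1} = {0..1}"
    by (auto intro!: image_eqI[of _ _ "1 - _"])
  ultimately show ?thesis by (simp add: integral_unique)
qed

text \<open>Stated for an arbitrary chain of derivatives so that the left formula can be treated by
  reflecting the chain.\<close>

lemma right_radau_bounds:
  fixes Df :: "nat \<Rightarrow> real \<Rightarrow> real"
  assumes Q: "is_right_radau n Q" and n: "4 \<le> n"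
    and D: "\<And>m s. m < 3 \<Longrightarrow> s \<in> {0..1} \<Longrightarrow>
      (Df m has_real_derivative Df (Suc m) s) (at s within {0..1})"
    and M: "\<And>s. s \<in> {0..1} \<Longrightarrow> 0 \<le> Df 3 s \<and> Df 3 s \<le> M"
  shows "remainder Q (Df 0) \<le> 0"
    and "- (sqrt 3 / (216 * real n ^ 3) - 1 / (269.14 * real n ^ 4)) * M \<le> remainder Q (Df 0)"
proof -
  obtain a \<tau> where Q_eq: "Q = quad (n + 1) a \<tau>" and \<tau>: "0 < \<tau> 0" "strict_mono_on {..n} \<tau>" "\<tau> n = 1"
    and exact: "\<forall>f\<in>spline_space n 3. remainder (quad (n + 1) a \<tau>) f = 0"
    using Q unfolding is_right_radau_def by blast
  interpret spline_quadrature n 3 "\<lambda>i. real n * a i" "\<lambda>i. real n * \<tau> i"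
    by (rule spline_quadrature_scaled) (use n \<tau> exact in auto)
  interpret radau n "\<lambda>i. real n * a i" "\<lambda>i. real n * \<tau> i"
    by unfold_locales (use \<tau> in simp)
  have \<tau>01: "\<tau> i \<in> {0..1}" if "i \<le> n" for i
    using node_bounds[OF that] n by (simp add: zero_less_mult_iff)
  have kernel: "0 \<le> - 1 * peano_kernel 3 n a \<tau> s" if "s \<in> {0..1}" for s
  proof -
    have "real n ^ 3 * peano_kernel 3 n a \<tau> s \<le> 0"
      using peano_kernel_eq_scaled[OF spline_quadrature_axioms, of s] kernel_nonpos[of "real n * s"] that
      by (simp add: mult_left_le)
    then show ?thesis using n by (simp add: mult_le_0_iff)
  qed
  have rem: "remainder Q (Df 0) = integral {0..1} (Df 0) - (\<Sum>i\<le>n. a i * Df 0 (\<tau> i))"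
    by (simp add: Q_eq remainder_def quad_def lessThan_Suc_atMost)
  note bounds = peano_kernel_nonneg_bounds[where Df = Df and p = 3 and n = n and a = a and \<tau> = \<tau> and \<sigma> = "-1" and M = M,
      OF D _ \<tau>01 quad_exact_power[OF _ _ exact] kernel M, folded rem]
  show "remainder Q (Df 0) \<le> 0"
    using bounds(1) by simp
  define S where "S = (\<Sum>i\<le>n. a i * \<tau> i ^ 3)"
  \<comment> \<open>Return to [0, 1]: n comes from the weights and n^3 from the nodes.\<close>
  have "(\<Sum>i\<le>n. real n * a i * (real n * \<tau> i) ^ 3) = real n ^ 4 * S"
    unfolding S_def sum_distrib_left by (intro sum.cong refl) (simp add: eval_nat_numeral)
  then have "real n ^ 4 * (- 1 * (1 / fact (Suc 3) - S / fact 3)) \<le> sqrt 3 * real n / 216 - 1 / 269.14"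
    using third_moment_bound[OF n] by (simp add: fact_numeral field_simps)
  also have "\<dots> = real n ^ 4 * (sqrt 3 / (216 * real n ^ 3) - 1 / (269.14 * real n ^ 4))"
    using n by (simp add: field_simps eval_nat_numeral)
  finally have "- 1 * (1 / fact (Suc 3) - S / fact 3) \<le> sqrt 3 / (216 * real n ^ 3) - 1 / (269.14 * real n ^ 4)"
    using n by (subst (asm) mult_le_cancel_left_pos) auto
  moreover have "0 \<le> M" using M[of 0] by simp
  ultimately have "- 1 * (1 / fact (Suc 3) - S / fact 3) * M \<le>
      (sqrt 3 / (216 * real n ^ 3) - 1 / (269.14 * real n ^ 4)) * M"
    by (rule mult_right_mono)
  moreover have "- 1 * remainder Q (Df 0) \<le> - 1 * (1 / fact (Suc 3) - S / fact 3) * M"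
    unfolding S_def by (rule bounds(2)) simp_all
  ultimately have "- remainder Q (Df 0) \<le> (sqrt 3 / (216 * real n ^ 3) - 1 / (269.14 * real n ^ 4)) * M"
    by linarith
  then show "- (sqrt 3 / (216 * real n ^ 3) - 1 / (269.14 * real n ^ 4)) * M \<le> remainder Q (Df 0)"
    unfolding mult_minus_left by (rule minus_le_iff[THEN iffD1])
qed

text \<open>The right formula is applied to g(x) = - f(1 - x), whose third derivative f'''(1 - x) is
  again nonnegative.\<close>

lemma left_radau_bounds:
  fixes Df :: "nat \<Rightarrow> real \<Rightarrow> real"
  assumes Q: "is_left_radau n Q" and n: "4 \<le> n"
    and D: "\<And>m s. m < 3 \<Longrightarrow> s \<in> {0..1} \<Longrightarrow>
      (Df m has_real_derivative Df (Suc m) s) (at s within {0..1})"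
    and M: "\<And>s. s \<in> {0..1} \<Longrightarrow> 0 \<le> Df 3 s \<and> Df 3 s \<le> M"
  shows "0 \<le> remainder Q (Df 0)"
    and "remainder Q (Df 0) \<le> (sqrt 3 / (216 * real n ^ 3) - 1 / (269.14 * real n ^ 4)) * M"
proof -
  obtain Q' where Q': "is_right_radau n Q'" and Q_eq: "Q = (\<lambda>f. Q' (\<lambda>x. f (1 - x)))"
    using Q unfolding is_left_radau_def by blast
  \<comment> \<open>The sign combines the leading minus with one factor -1 from the chain rule per
    derivative.\<close>
  define Dg where "Dg j x = (- 1) ^ Suc j * Df j (1 - x)" for j x
  have Dg: "(Dg m has_real_derivative Dg (Suc m) s) (at s within {0..1})"
    if "m < 3" "s \<in> {0..1}" for m s
  proof -
    have "((\<lambda>x. Df m (1 - x)) has_real_derivative Df (Suc m) (1 - s) * - 1) (at s within {0..1})"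
    proof (rule DERIV_image_chain[where f = "Df m" and g = "\<lambda>x. 1 - x", unfolded o_def])
      show "(Df m has_real_derivative Df (Suc m) (1 - s)) (at (1 - s) within (\<lambda>x. 1 - x) ` {0..1})"
        by (rule DERIV_subset[OF D[OF that(1)]]) (use that in auto)
    qed (auto intro!: derivative_eq_intros)
    from DERIV_cmult[OF this, of "(- 1) ^ Suc m"] show ?thesis
      by (simp add: Dg_def[abs_def])
  qed
  have M': "0 \<le> Dg 3 s \<and> Dg 3 s \<le> M" if "s \<in> {0..1}" for s
    using M[of "1 - s"] that by (simp add: Dg_def)
  have cont: "continuous_on {0..1} (Df 0)"
    using D[of 0] by (intro DERIV_continuous_on[of _ _ "Df 1"]) auto
  obtain a \<tau> where "Q' = quad (n + 1) a \<tau>"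
    using Q' unfolding is_right_radau_def by blast
  then have "remainder Q' (Dg 0) = - remainder Q (Df 0)"
    using integral_reflect_01[OF cont]
    by (simp add: Q_eq Dg_def[abs_def] remainder_def quad_def sum_negf)
  with right_radau_bounds[OF Q' n Dg M']
  show "0 \<le> remainder Q (Df 0)"
    and "remainder Q (Df 0) \<le> (sqrt 3 / (216 * real n ^ 3) - 1 / (269.14 * real n ^ 4)) * M"
    by (simp_all only: mult_minus_left neg_le_iff_le neg_le_0_iff_le)
qed

lemma gauss_bounds:
  fixes Df :: "nat \<Rightarrow> real \<Rightarrow> real"
  assumes Q: "is_gauss n Q" and n: "4 \<le> n"
    and D: "\<And>m s. m < 4 \<Longrightarrow> s \<in> {0..1} \<Longrightarrow>
      (Df m has_real_derivative Df (Suc m) s) (at s within {0..1})"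
    and M: "\<And>s. s \<in> {0..1} \<Longrightarrow> 0 \<le> Df 4 s \<and> Df 4 s \<le> M"
  shows "0 \<le> remainder Q (Df 0)"
    and "remainder Q (Df 0) \<le> (1 / (720 * real n ^ 4) - 1 / (552 * real n ^ 5)) * M"
proof -
  obtain a \<tau> where Q_eq: "Q = quad (n + 1) a \<tau>" and \<tau>: "0 < \<tau> 0" "strict_mono_on {..n} \<tau>" "\<tau> n < 1"
    and exact: "\<forall>f\<in>spline_space n 4. remainder (quad (n + 1) a \<tau>) f = 0"
    using Q unfolding is_gauss_def by blast
  interpret spline_quadrature n 4 "\<lambda>i. real n * a i" "\<lambda>i. real n * \<tau> i"
    by (rule spline_quadrature_scaled) (use n \<tau> exact in auto)
  interpret gauss n "\<lambda>i. real n * a i" "\<lambda>i. real n * \<tau> i"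
    by unfold_locales (use \<tau> n in simp)
  have \<tau>01: "\<tau> i \<in> {0..1}" if "i \<le> n" for i
    using node_bounds[OF that] n by (simp add: zero_less_mult_iff)
  have kernel: "0 \<le> 1 * peano_kernel 4 n a \<tau> s" if "s \<in> {0..1}" for s
  proof -
    have "0 \<le> real n ^ 4 * peano_kernel 4 n a \<tau> s"
      using peano_kernel_eq_scaled[OF spline_quadrature_axioms, of s] kernel_nonneg[of "real n * s"] that
      by (simp add: mult_left_le)
    then show ?thesis using n by (simp add: zero_le_mult_iff)
  qed
  have rem: "remainder Q (Df 0) = integral {0..1} (Df 0) - (\<Sum>i\<le>n. a i * Df 0 (\<tau> i))"
    by (simp add: Q_eq remainder_def quad_def lessThan_Suc_atMost)
  note bounds = peano_kernel_nonneg_bounds[where Df = Df and p = 4 and n = n and a = a and \<tau> = \<tau> and \<sigma> = 1 and M = M,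
      OF D _ \<tau>01 quad_exact_power[OF _ _ exact] kernel M, folded rem]
  show "0 \<le> remainder Q (Df 0)"
    using bounds(1) by simp
  define S where "S = (\<Sum>i\<le>n. a i * \<tau> i ^ 4)"
  have "(\<Sum>i\<le>n. real n * a i * (real n * \<tau> i) ^ 4) = real n ^ 5 * S"
    unfolding S_def sum_distrib_left by (intro sum.cong refl) (simp add: eval_nat_numeral)
  \<comment> \<open>Division by 4! = 24 turns n / 30 into n / 720 and 1 / 23 into 1 / 552.\<close>
  then have "real n ^ 5 * (1 * (1 / fact (Suc 4) - S / fact 4)) \<le> (real n / 30 - 1 / 23) / 24"
    using fourth_moment_bound[OF n] by (simp add: fact_numeral field_simps)
  also have "\<dots> = real n ^ 5 * (1 / (720 * real n ^ 4) - 1 / (552 * real n ^ 5))"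
    using n by (simp add: field_simps eval_nat_numeral)
  finally have "1 * (1 / fact (Suc 4) - S / fact 4) \<le> 1 / (720 * real n ^ 4) - 1 / (552 * real n ^ 5)"
    using n by (subst (asm) mult_le_cancel_left_pos) auto
  moreover have "0 \<le> M" using M[of 0] by simp
  ultimately have "1 * (1 / fact (Suc 4) - S / fact 4) * M \<le> (1 / (720 * real n ^ 4) - 1 / (552 * real n ^ 5)) * M"
    by (rule mult_right_mono)
  with bounds(2) show "remainder Q (Df 0) \<le> (1 / (720 * real n ^ 4) - 1 / (552 * real n ^ 5)) * M"
    unfolding S_def by simp
qed

theorem corollary1:
  shows "(\<forall>f. f \<in> C01 3 \<longrightarrow> (\<forall>x\<in>{0..1}. higher_deriv01 3 f x \<ge> 0) \<longrightarrow>
    (\<forall>n\<ge>4.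
      (\<forall>Q. is_left_radau n Q \<longrightarrow>
        0 \<le> remainder Q f \<and>
        remainder Q f \<le> (sqrt 3 / (216 * real n ^ 3) - 1 / (269.14 * real n ^ 4))
                         * supnorm01 (higher_deriv01 3 f)) \<and>
      (\<forall>Q. is_right_radau n Q \<longrightarrow>
        0 \<ge> remainder Q f \<and>
        remainder Q f \<ge> - (sqrt 3 / (216 * real n ^ 3) - 1 / (269.14 * real n ^ 4))
                         * supnorm01 (higher_deriv01 3 f)))) \<and>
    (\<forall>f. f \<in> C01 4 \<longrightarrow> (\<forall>x\<in>{0..1}. higher_deriv01 4 f x \<ge> 0) \<longrightarrow>
    (\<forall>n\<ge>4. \<forall>Q. is_gauss n Q \<longrightarrow>
        0 \<le> remainder Q f \<and>
        remainder Q f \<le> (1 / (720 * real n ^ 4) - 1 / (552 * real n ^ 5))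
                         * supnorm01 (higher_deriv01 4 f)))"
proof (intro conjI allI impI)
  fix f :: "real \<Rightarrow> real" and n :: nat and Q
  assume f: "f \<in> C01 3" "\<forall>x\<in>{0..1}. 0 \<le> higher_deriv01 3 f x" and n: "4 \<le> n"
  have M: "0 \<le> higher_deriv01 3 f s \<and> higher_deriv01 3 f s \<le> supnorm01 (higher_deriv01 3 f)"
    if "s \<in> {0..1}" for s
    using f that le_supnorm01[of "higher_deriv01 3 f" s] by (simp add: C01_def)
  have f0: "higher_deriv01 0 f = f" by (simp add: higher_deriv01_def)
  note D = C01_has_real_derivative[OF f(1)]
  show "0 \<le> remainder Q f"
    and "remainder Q f \<le> (sqrt 3 / (216 * real n ^ 3) - 1 / (269.14 * real n ^ 4))
      * supnorm01 (higher_deriv01 3 f)"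
    if "is_left_radau n Q"
    using left_radau_bounds[where Df = "\<lambda>j. higher_deriv01 j f", OF that n D M] by (auto simp: f0)
  show "0 \<ge> remainder Q f"
    and "remainder Q f \<ge> - (sqrt 3 / (216 * real n ^ 3) - 1 / (269.14 * real n ^ 4))
      * supnorm01 (higher_deriv01 3 f)"
    if "is_right_radau n Q"
    using right_radau_bounds[where Df = "\<lambda>j. higher_deriv01 j f", OF that n D M] by (auto simp: f0)
next
  fix f :: "real \<Rightarrow> real" and n :: nat and Q
  assume f: "f \<in> C01 4" "\<forall>x\<in>{0..1}. 0 \<le> higher_deriv01 4 f x" and n: "4 \<le> n" and Q: "is_gauss n Q"
  have M: "0 \<le> higher_deriv01 4 f s \<and> higher_deriv01 4 f s \<le> supnorm01 (higher_deriv01 4 f)"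
    if "s \<in> {0..1}" for s
    using f that le_supnorm01[of "higher_deriv01 4 f" s] by (simp add: C01_def)
  have f0: "higher_deriv01 0 f = f" by (simp add: higher_deriv01_def)
  note D = C01_has_real_derivative[OF f(1)]
  show "0 \<le> remainder Q f"
    and "remainder Q f \<le> (1 / (720 * real n ^ 4) - 1 / (552 * real n ^ 5)) * supnorm01 (higher_deriv01 4 f)"
    using gauss_bounds[where Df = "\<lambda>j. higher_deriv01 j f", OF Q n D M] by (auto simp: f0)
qed

end
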